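(* The map $\mathcal{I}_h$ is a homotopy invariant of (classical) pseudoknots. That is, if $D$ and $D'$ are oriented pseudodiagrams of homotopic pseudoknots, with Gauss diagrams $P$ and $P'$, then $\mathcal{I}_h(P)=\mathcal{I}_h(P')$ in $\mathbb{Z}_2\mathcal{C}$.
   Context: **Pseudodiagrams and pseudoknots.** An (oriented, one-component) pseudodiagram is a generic immersion of an oriented circle in the plane (finitely many singularities, all transverse double points) where each double point is either a *classical crossing*, with over/under information, or a *precrossing*, with no such information. A *pseudoknot* is an equivalence class of pseudodiagrams under the relation generated by planar isotopy and the following local moves (for all orientations of strands): - R1, R2, R3: the classical Reidemeister moves, involving only classical crossings. - PR1: create or remove a kink (an empty monogon) whose double point is a precrossing. - PR2: if two strands meet in a precrossing and in a classical crossing that together bound an empty bigon, the classical crossing may be moved to the other side of the precrossing; in terms of singular braids on two strands, $\sigma^{\pm1}\tau=\tau\sigma^{\pm1}$, where $\sigma$ is the classical crossing generator and $\tau$ the precrossing. - PR3: a strand passing over both strands of a precrossing (or under both strands), with classical crossings, may be slid across the precrossing, remaining over (respectively under). Two pseudoknots are *homotopic* if their pseudodiagrams are related by a finite sequence of planar isotopies, the moves R1, R2, R3, PR1, PR2, PR3, and *crossing changes* (exchanging the over- and under-strand at a classical crossing). **Gauss diagram of a pseudodiagram.** It is an oriented (counterclockwise) circle parametrizing the curve, with a chord joining the two preimages of each double point. For a classical crossing, the chord is a *classical arrow* pointing from the over-strand to the under-strand and decorated with the sign $\pm1$ of the crossing. For a precrossing, the chord is a *precrossing arrow* without sign, pointing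 in the direction in which the classical arrow would point if the precrossing were resolved to a positive crossing. Gauss diagrams are considered up to orientation-preserving homeomorphism of the circle. Two chords *intersect* if their endpoints alternate on the circle. **The map $\mathcal{I}_h$.** Let $\mathbb{Z}_2\mathcal{C}$ be the set of all chord diagrams (on an oriented circle, up to orientation-preserving homeomorphism) in which each chord is decorated with a $0$ or $1$. For the Gauss diagram $P$ of a pseudodiagram, $\mathcal{I}_h(P)\in\mathbb{Z}_2\mathcal{C}$ is obtained as follows: 1. Replace all arrows in $P$ that are associated to precrossings with unoriented chords, called *prechords*. 2. Decorate each prechord $c$ with the $\mathbb{Z}_2$ value $p(c)$, the parity of the number of classical arrows that intersect $c$. 3. Delete all classical arrows. 4. Delete any prechords $c$ that have adjacent endpoints and $p(c)=0$. *)

theory Defs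
  imports "HOL-Analysis.Analysis" "HOL-Library.Z2" "HOL-Library.Confluence"
begin

section \<open>Pseudodiagrams\<close>

text \<open>
  The oriented circle is \<open>\<real>/\<int>\<close>, with fundamental domain \<open>{0..<1}\<close>. A pseudodiagram is a
  1-periodic curve together with a relation \<open>over\<close> on parameters: \<open>(s, t) \<in> over D\<close> means that the
  double point with preimages \<open>s\<close> and \<open>t\<close> is a classical crossing at which the strand through
  \<open>s\<close> passes over. Double points that \<open>over D\<close> does not mention are the precrossings.
\<close>

datatype pseudo = Pseudo (curve: "real \<Rightarrow> complex") (over: "(real \<times> real) set")

definition smooth_curve :: "(real \<Rightarrow> complex) \<Rightarrow> bool" where
  "smooth_curve c \<longleftrightarrow>
     (\<exists>d :: nat \<Rightarrow> real \<Rightarrow> complex. d 0 = c \<and>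
        (\<forall>n t. (d n has_vector_derivative d (Suc n) t) (at t)))"

definition velocity :: "(real \<Rightarrow> complex) \<Rightarrow> real \<Rightarrow> complex" where
  "velocity c t = vector_derivative c (at t)"

definition det2 :: "complex \<Rightarrow> complex \<Rightarrow> real" where
  "det2 u v = Re u * Im v - Im u * Re v"

text \<open>Each double point with preimages in \<open>U\<close> appears twice, as \<open>(s, t)\<close> and as \<open>(t, s)\<close>.\<close>

definition double_pairs :: "(real \<Rightarrow> complex) \<Rightarrow> real set \<Rightarrow> (real \<times> real) set" where
  "double_pairs c U = {(s, t). s \<in> U \<and> t \<in> U \<and> s \<noteq> t \<and> c s = c t}"

definition generic_immersion :: "(real \<Rightarrow> complex) \<Rightarrow> bool" where
  "generic_immersion c \<longleftrightarrow>
     (\<forall>t. c (t + 1) = c t) \<and>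
     smooth_curve c \<and>
     (\<forall>t. velocity c t \<noteq> 0) \<and>
     finite (double_pairs c {0..<1}) \<and>
     (\<forall>s t u. (s, t) \<in> double_pairs c {0..<1} \<and> (s, u) \<in> double_pairs c {0..<1} \<longrightarrow> t = u) \<and>
     (\<forall>(s, t) \<in> double_pairs c {0..<1}. det2 (velocity c s) (velocity c t) \<noteq> 0)"

definition pseudodiagram :: "pseudo \<Rightarrow> bool" where
  "pseudodiagram D \<longleftrightarrow>
     generic_immersion (curve D) \<and>
     over D \<subseteq> double_pairs (curve D) {0..<1} \<and>
     (\<forall>(s, t) \<in> over D. (t, s) \<notin> over D)"

definition precrossing_pairs :: "pseudo \<Rightarrow> (real \<times> real) set" where
  "precrossing_pairs D = double_pairs (curve D) {0..<1} - (over D \<union> (over D)\<inverse>)"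


section \<open>Planar isotopy\<close>

text \<open>Lifts to \<open>\<real>\<close> of the orientation-preserving homeomorphisms of \<open>\<real>/\<int>\<close>.\<close>

definition circle_homeo :: "(real \<Rightarrow> real) \<Rightarrow> bool" where
  "circle_homeo f \<longleftrightarrow>
     continuous_on UNIV f \<and> strict_mono f \<and> (\<forall>x. f (x + 1) = f x + 1)"

definition circle_act :: "(real \<Rightarrow> real) \<Rightarrow> real \<Rightarrow> real" where
  "circle_act f x = frac (f x)"

definition ambient_isotopy :: "(real \<Rightarrow> complex \<Rightarrow> complex) \<Rightarrow> bool" where
  "ambient_isotopy H \<longleftrightarrow>
     continuous_on ({0..1} \<times> UNIV) (\<lambda>(s, z). H s z) \<and>
     (\<forall>z. H 0 z = z) \<and>
     (\<forall>s \<in> {0..1}. \<exists>G. homeomorphism UNIV UNIV (H s) G)"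

text \<open>The map \<open>f\<close> accounts for the fact that the parametrization of the curve is not part of the
  diagram.\<close>

definition planar_isotopy :: "pseudo \<Rightarrow> pseudo \<Rightarrow> bool" where
  "planar_isotopy D D' \<longleftrightarrow>
     (\<exists>H f. ambient_isotopy H \<and> circle_homeo f \<and>
        (\<forall>t. curve D' t = H 1 (curve D (f t))) \<and>
        over D' = {(s, t). s \<in> {0..<1} \<and> t \<in> {0..<1} \<and>
                           (circle_act f s, circle_act f t) \<in> over D})"


section \<open>Local moves\<close>

text \<open>
  A local move changes a diagram only inside a closed topological disc that the curve meets in
  finitely many arcs, properly embedded apart from the double points. A strand is given by its
  closed parameter interval \<open>(a, b)\<close>. That the base point of the parametrization lies
  outside the disc is no restriction, because \<^const>\<open>planar_isotopy\<close> allows rotations of the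
  parameter circle. Every move is described by the double points on its strands and their positions
  along the strands; by the Schoenflies theorem this determines the picture in the disc up to
  homeomorphism.
\<close>

type_synonym strand = "real \<times> real"

definition strand_params :: "strand \<Rightarrow> real set" where
  "strand_params I = {fst I..snd I}"

definition inner_params :: "strand \<Rightarrow> real set" where
  "inner_params I = {fst I<..<snd I}"

definition all_params :: "strand list \<Rightarrow> real set" where
  "all_params S = (\<Union>I \<in> set S. strand_params I)"

definition meets_disc_in :: "(real \<Rightarrow> complex) \<Rightarrow> complex set \<Rightarrow> strand list \<Rightarrow> bool" where
  "meets_disc_in c B S \<longleftrightarrow>
     B homeomorphic (cball 0 1 :: complex set) \<and>
     (\<forall>(a, b) \<in> set S. 0 < a \<and> a < b \<and> b < 1) \<and>
     sorted_wrt (\<lambda>I J. strand_params I \<inter> strand_params J = {}) S \<and>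
     {t \<in> {0..<1}. c t \<in> B} = all_params S \<and>
     (\<forall>(a, b) \<in> set S. c a \<in> frontier B \<and> c b \<in> frontier B) \<and>
     (\<forall>I \<in> set S. c ` inner_params I \<subseteq> interior B)"

definition local_change :: "pseudo \<Rightarrow> pseudo \<Rightarrow> strand list \<Rightarrow> bool" where
  "local_change D D' S \<longleftrightarrow>
     (\<exists>B. meets_disc_in (curve D) B S \<and> meets_disc_in (curve D') B S) \<and>
     (\<forall>t \<in> {0..<1} - all_params S. curve D t = curve D' t) \<and>
     over D - all_params S \<times> all_params S = over D' - all_params S \<times> all_params S"

text \<open>The double points of \<open>D\<close> on the strands \<open>S\<close> are those with preimage pairs in \<open>X\<close>, and \<open>V\<close>
  is the over/under information there.\<close>

definition tangle :: "pseudo \<Rightarrow> strand list \<Rightarrow> (real \<times> real) set \<Rightarrow> (real \<times> real) set \<Rightarrow> bool" where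
  "tangle D S X V \<longleftrightarrow>
     double_pairs (curve D) (all_params S) = X \<union> X\<inverse> \<and>
     over D \<inter> all_params S \<times> all_params S = V"

definition R1_move :: "pseudo \<Rightarrow> pseudo \<Rightarrow> bool" where
  "R1_move D D' \<longleftrightarrow>
     (\<exists>I s t. local_change D D' [I] \<and> s \<in> inner_params I \<and> t \<in> inner_params I \<and>
        tangle D [I] {} {} \<and> tangle D' [I] {(s, t)} {(s, t)})"

definition PR1_move :: "pseudo \<Rightarrow> pseudo \<Rightarrow> bool" where
  "PR1_move D D' \<longleftrightarrow>
     (\<exists>I s t. local_change D D' [I] \<and> s \<in> inner_params I \<and> t \<in> inner_params I \<and>
        tangle D [I] {} {} \<and> tangle D' [I] {(s, t)} {})"

definition R2_move :: "pseudo \<Rightarrow> pseudo \<Rightarrow> bool" where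
  "R2_move D D' \<longleftrightarrow>
     (\<exists>I1 I2 x1 x2 y1 y2. local_change D D' [I1, I2] \<and>
        x1 \<in> inner_params I1 \<and> y1 \<in> inner_params I1 \<and> x1 \<noteq> y1 \<and>
        x2 \<in> inner_params I2 \<and> y2 \<in> inner_params I2 \<and> x2 \<noteq> y2 \<and>
        tangle D [I1, I2] {} {} \<and>
        tangle D' [I1, I2] {(x1, x2), (y1, y2)} {(x1, x2), (y1, y2)})"

text \<open>
  In the second Reidemeister move for precrossings, \<open>x\<close> is the classical crossing and \<open>y\<close> the
  precrossing, and their order is exchanged along both strands. The classical crossing keeps its
  sign, as in \<open>\<sigma>\<tau> = \<tau>\<sigma>\<close>. The frame (velocity of strand 1, velocity of strand 2) has opposite
  orientations at the two corners of a bigon, so the over-strand changes from \<open>I1\<close> to \<open>I2\<close>.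
\<close>

definition PR2_move :: "pseudo \<Rightarrow> pseudo \<Rightarrow> bool" where
  "PR2_move D D' \<longleftrightarrow>
     (\<exists>I1 I2 x1 x2 y1 y2 x1' x2' y1' y2'. local_change D D' [I1, I2] \<and>
        {x1, y1, x1', y1'} \<subseteq> inner_params I1 \<and>
        {x2, y2, x2', y2'} \<subseteq> inner_params I2 \<and>
        x1 \<noteq> y1 \<and> x2 \<noteq> y2 \<and> x1' \<noteq> y1' \<and> x2' \<noteq> y2' \<and>
        (x1 < y1 \<longleftrightarrow> y1' < x1') \<and> (x2 < y2 \<longleftrightarrow> y2' < x2') \<and>
        tangle D [I1, I2] {(x1, x2), (y1, y2)} {(x1, x2)} \<and>
        tangle D' [I1, I2] {(x1', x2'), (y1', y2')} {(x2', x1')})"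

text \<open>
  Three strands that cross pairwise exactly once, before and after the third one is slid across the
  crossing of the other two; \<open>xij\<close> is the parameter on strand \<open>i\<close> of its crossing with strand \<open>j\<close>.
  The two crossings on each strand exchange their order.
\<close>

definition slide_params :: "strand \<Rightarrow> real \<Rightarrow> real \<Rightarrow> real \<Rightarrow> real \<Rightarrow> bool" where
  "slide_params I u v u' v' \<longleftrightarrow>
     {u, v, u', v'} \<subseteq> inner_params I \<and> u \<noteq> v \<and> u' \<noteq> v' \<and> (u < v \<longleftrightarrow> v' < u')"

definition R3_move :: "pseudo \<Rightarrow> pseudo \<Rightarrow> bool" where
  "R3_move D D' \<longleftrightarrow>
     (\<exists>I1 I2 I3 x12 x13 x21 x23 x31 x32 y12 y13 y21 y23 y31 y32.
        local_change D D' [I1, I2, I3] \<and>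
        slide_params I1 x12 x13 y12 y13 \<and>
        slide_params I2 x21 x23 y21 y23 \<and>
        slide_params I3 x31 x32 y31 y32 \<and>
        tangle D [I1, I2, I3] {(x12, x21), (x13, x31), (x23, x32)}
                              {(x12, x21), (x13, x31), (x23, x32)} \<and>
        tangle D' [I1, I2, I3] {(y12, y21), (y13, y31), (y23, y32)}
                               {(y12, y21), (y13, y31), (y23, y32)})"

definition PR3_move :: "pseudo \<Rightarrow> pseudo \<Rightarrow> bool" where
  "PR3_move D D' \<longleftrightarrow>
     (\<exists>I1 I2 I3 x12 x13 x21 x23 x31 x32 y12 y13 y21 y23 y31 y32 V V'.
        local_change D D' [I1, I2, I3] \<and>
        slide_params I1 x12 x13 y12 y13 \<and>
        slide_params I2 x21 x23 y21 y23 \<and>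
        slide_params I3 x31 x32 y31 y32 \<and>
        tangle D [I1, I2, I3] {(x12, x21), (x13, x31), (x23, x32)} V \<and>
        tangle D' [I1, I2, I3] {(y12, y21), (y13, y31), (y23, y32)} V' \<and>
        (V = {(x31, x13), (x32, x23)} \<and> V' = {(y31, y13), (y32, y23)} \<or>
         V = {(x13, x31), (x23, x32)} \<and> V' = {(y13, y31), (y23, y32)}))"


section \<open>Pseudoknots and homotopy\<close>

definition pseudo_move :: "pseudo \<Rightarrow> pseudo \<Rightarrow> bool" where
  "pseudo_move D D' \<longleftrightarrow>
     pseudodiagram D \<and> pseudodiagram D' \<and>
     (planar_isotopy D D' \<or> R1_move D D' \<or> R2_move D D' \<or> R3_move D D' \<or>
      PR1_move D D' \<or> PR2_move D D' \<or> PR3_move D D')"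

definition crossing_change :: "pseudo \<Rightarrow> pseudo \<Rightarrow> bool" where
  "crossing_change D D' \<longleftrightarrow>
     pseudodiagram D \<and> pseudodiagram D' \<and> curve D' = curve D \<and>
     (\<exists>s t. (s, t) \<in> over D \<and> over D' = insert (t, s) (over D - {(s, t)}))"

definition pseudoknot_of :: "pseudo \<Rightarrow> pseudo set" where
  "pseudoknot_of D = {D'. pseudodiagram D' \<and> equivclp pseudo_move D D'}"

definition homotopic_pseudoknots :: "pseudo set \<Rightarrow> pseudo set \<Rightarrow> bool" where
  "homotopic_pseudoknots K K' \<longleftrightarrow>
     (\<exists>D \<in> K. \<exists>D' \<in> K'. equivclp (\<lambda>E E'. pseudo_move E E' \<or> crossing_change E E') D D')"


section \<open>Gauss diagrams\<close>

datatype label = Classical int | Precrossing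

text \<open>An arrow is (tail, head, label).\<close>

type_synonym gauss = "(real \<times> real \<times> label) set"

text \<open>
  A classical crossing is positive iff (velocity of the over-strand, velocity of the under-strand)
  is a positively oriented frame.
\<close>

definition gauss_of :: "pseudo \<Rightarrow> gauss" where
  "gauss_of D =
     {(s, t, Classical (if det2 (velocity (curve D) s) (velocity (curve D) t) > 0 then 1 else - 1)) |
        s t. (s, t) \<in> over D} \<union>
     {(s, t, Precrossing) |
        s t. (s, t) \<in> precrossing_pairs D \<and>
             det2 (velocity (curve D) s) (velocity (curve D) t) > 0}"

definition is_gauss_diagram :: "gauss \<Rightarrow> pseudo \<Rightarrow> bool" where
  "is_gauss_diagram P D \<longleftrightarrow>
     (\<exists>f. circle_homeo f \<and>
        P = (\<lambda>(s, t, l). (circle_act f s, circle_act f t, l)) ` gauss_of D)"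


section \<open>Decorated chord diagrams and the invariant\<close>

type_synonym chord = "real set"
type_synonym decorated = "(chord \<times> bit) set"

definition chord_diagram :: "decorated \<Rightarrow> bool" where
  "chord_diagram X \<longleftrightarrow>
     finite X \<and>
     (\<forall>(k, e) \<in> X. k \<subseteq> {0..<1} \<and> card k = 2) \<and>
     (\<forall>p \<in> X. \<forall>q \<in> X. p \<noteq> q \<longrightarrow> fst p \<inter> fst q = {})"

definition chord_class :: "decorated \<Rightarrow> decorated set" where
  "chord_class X = {(\<lambda>(k, e). (circle_act f ` k, e)) ` X | f. circle_homeo f}"

definition Z2C :: "decorated set set" where
  "Z2C = chord_class ` {X. chord_diagram X}"

definition chords_intersect :: "chord \<Rightarrow> chord \<Rightarrow> bool" where
  "chords_intersect k l \<longleftrightarrow>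
     (\<exists>a b c d. k = {a, b} \<and> l = {c, d} \<and> a < c \<and> c < b \<and> (d < a \<or> b < d))"

definition chord_parity :: "gauss \<Rightarrow> chord \<Rightarrow> bit" where
  "chord_parity P k =
     of_nat (card {(s, t, l) \<in> P. l \<noteq> Precrossing \<and> chords_intersect k {s, t}})"

definition decorated_prechords :: "gauss \<Rightarrow> decorated" where
  "decorated_prechords P = {({s, t}, chord_parity P {s, t}) | s t. (s, t, Precrossing) \<in> P}"

definition adjacent_endpoints :: "decorated \<Rightarrow> chord \<Rightarrow> bool" where
  "adjacent_endpoints X k \<longleftrightarrow>
     (\<exists>a b. k = {a, b} \<and> a < b \<and>
        ({a<..<b} \<inter> \<Union>(fst ` X) = {} \<or> ({0..<1} - {a..b}) \<inter> \<Union>(fst ` X) = {}))"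

inductive delete_chord :: "decorated \<Rightarrow> decorated \<Rightarrow> bool" where
  "(k, 0) \<in> X \<Longrightarrow> adjacent_endpoints X k \<Longrightarrow> delete_chord X (X - {(k, 0)})"

text \<open>Chords are deleted as long as possible: a deletion may make the endpoints of another chord
  adjacent.\<close>

definition fully_reduced :: "decorated \<Rightarrow> decorated \<Rightarrow> bool" where
  "fully_reduced X Y \<longleftrightarrow> delete_chord\<^sup>*\<^sup>* X Y \<and> (\<nexists>Z. delete_chord Y Z)"

definition reduced :: "decorated \<Rightarrow> decorated" where
  "reduced X = (THE Y. fully_reduced X Y)"

definition I_h :: "gauss \<Rightarrow> decorated set" where
  "I_h P = chord_class (reduced (decorated_prechords P))"


section \<open>The invariant is well defined\<close>

lemma adjacent_endpoints_subset:
  assumes "adjacent_endpoints X k" "Y \<subseteq> X"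
  shows "adjacent_endpoints Y k"
proof -
  obtain a b where ab: "k = {a, b}" "a < b"
    and disj: "{a<..<b} \<inter> \<Union>(fst ` X) = {} \<or> ({0..<1} - {a..b}) \<inter> \<Union>(fst ` X) = {}"
    using assms(1) unfolding adjacent_endpoints_def by blast
  have "\<Union>(fst ` Y) \<subseteq> \<Union>(fst ` X)" using assms(2) by blast
  with disj have "{a<..<b} \<inter> \<Union>(fst ` Y) = {} \<or> ({0..<1} - {a..b}) \<inter> \<Union>(fst ` Y) = {}"
    by blast
  with ab show ?thesis unfolding adjacent_endpoints_def by blast
qed

lemma delete_chord_diamond:
  assumes "delete_chord X Y" "delete_chord X Z"
  shows "Y = Z \<or> (\<exists>W. delete_chord Y W \<and> delete_chord Z W)"
proof -
  obtain k where k: "(k, 0) \<in> X" "adjacent_endpoints X k" "Y = X - {(k, 0)}"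
    using assms(1) by (auto elim: delete_chord.cases)
  obtain l where l: "(l, 0) \<in> X" "adjacent_endpoints X l" "Z = X - {(l, 0)}"
    using assms(2) by (auto elim: delete_chord.cases)
  show ?thesis
  proof (cases "k = l")
    case False
    have "adjacent_endpoints Y l" "adjacent_endpoints Z k"
      using k l by (auto intro: adjacent_endpoints_subset)
    then have "delete_chord Y (Y - {(l, 0)})" "delete_chord Z (Z - {(k, 0)})"
      using k l False by (auto intro!: delete_chord.intros)
    moreover have "Y - {(l, 0)} = Z - {(k, 0)}" using k l by auto
    ultimately show ?thesis by metis
  qed (use k l in simp)
qed

lemma fully_reduced_ex:
  assumes "finite X"
  shows "\<exists>Y. fully_reduced X Y"
  using assms
proof (induction X rule: finite_psubset_induct)
  case (psubset X)
  show ?case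
  proof (cases "\<exists>Z. delete_chord X Z")
    case True
    then obtain Z where Z: "delete_chord X Z" by blast
    then have "Z \<subset> X" by (auto elim: delete_chord.cases)
    then obtain Y where "fully_reduced Z Y" using psubset.IH by blast
    with Z show ?thesis unfolding fully_reduced_def by (meson converse_rtranclp_into_rtranclp)
  qed (auto simp: fully_reduced_def)
qed

lemma fully_reduced_unique:
  assumes "fully_reduced X Y" "fully_reduced X Z"
  shows "Y = Z"
proof -
  have "strong_confluentp delete_chord"
    by (rule strong_confluentpI) (use delete_chord_diamond in blast)
  then have "confluentp delete_chord" by (rule strong_confluentp_imp_confluentp)
  then obtain W where W: "delete_chord\<^sup>*\<^sup>* Y W" "delete_chord\<^sup>*\<^sup>* Z W"
    using assms unfolding fully_reduced_def by (meson confluentpD)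
  have "V = W" if "fully_reduced X V" "delete_chord\<^sup>*\<^sup>* V W" for V
    using that(2,1) by (cases rule: converse_rtranclpE) (auto simp: fully_reduced_def)
  from this[OF assms(1) W(1)] this[OF assms(2) W(2)] show ?thesis by simp
qed

lemma fully_reduced_reduced: "finite X \<Longrightarrow> fully_reduced X (reduced X)"
  unfolding reduced_def
  by (rule theI', rule ex_ex1I[OF fully_reduced_ex fully_reduced_unique])

lemma reduced_subset:
  assumes "finite X"
  shows "reduced X \<subseteq> X"
proof -
  have "delete_chord\<^sup>*\<^sup>* X Y \<Longrightarrow> Y \<subseteq> X" for Y
    by (induction rule: rtranclp_induct) (auto elim: delete_chord.cases)
  moreover have "delete_chord\<^sup>*\<^sup>* X (reduced X)"
    using fully_reduced_reduced[OF assms] unfolding fully_reduced_def by (rule conjunct1)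
  ultimately show ?thesis .
qed

lemma inj_on_circle_act:
  assumes "circle_homeo f"
  shows "inj_on (circle_act f) {0..<1}"
proof -
  have *: "x = y" if "x \<le> y" "x \<in> {0..<1}" "y \<in> {0..<1}" "frac (f x) = frac (f y)" for x y
  proof -
    have sm: "strict_mono f" and per: "f (x + 1) = f x + 1"
      using assms by (auto simp: circle_homeo_def)
    have "f x \<le> f y" using sm that(1) by (simp add: strict_mono_less_eq)
    moreover have "f y < f (x + 1)"
      using that(2,3) by (intro strict_monoD[OF sm]) auto
    then have "f y < f x + 1" using per by simp
    moreover have "f y - f x = of_int (\<lfloor>f y\<rfloor> - \<lfloor>f x\<rfloor>)"
      using that(4) by (simp add: frac_def)
    ultimately have "\<lfloor>f y\<rfloor> - \<lfloor>f x\<rfloor> = 0" by linarith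
    then have "f x = f y" using that(4) by (simp add: frac_def)
    then show ?thesis using sm by (simp add: strict_mono_eq)
  qed
  show ?thesis
  proof (rule inj_onI)
    fix x y assume "x \<in> {0..<1}" "y \<in> {0..<1}" "circle_act f x = circle_act f y"
    then show "x = y"
      using *[of x y] *[of y x] by (cases "x \<le> y") (auto simp: circle_act_def)
  qed
qed

theorem I_h_in_Z2C:
  assumes D: "pseudodiagram D" and P: "is_gauss_diagram P D"
  shows "I_h P \<in> Z2C"
proof -
  obtain f where f: "circle_homeo f"
    and Pf: "P = (\<lambda>(s, t, l). (circle_act f s, circle_act f t, l)) ` gauss_of D"
    using P unfolding is_gauss_diagram_def by blast
  let ?g = "circle_act f" and ?c = "curve D"
  define A where "A = {(s, t). (s, t) \<in> precrossing_pairs D \<and>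
    det2 (velocity ?c s) (velocity ?c t) > 0}"
  have A_dbl: "A \<subseteq> double_pairs ?c {0..<1}"
    by (auto simp: A_def precrossing_pairs_def)
  have fin: "finite A"
    using A_dbl D by (auto simp: pseudodiagram_def generic_immersion_def intro: finite_subset)
  have uniq: "t = u" if "(s, t) \<in> double_pairs ?c {0..<1}" "(s, u) \<in> double_pairs ?c {0..<1}" for s t u
    using D that unfolding pseudodiagram_def generic_immersion_def by blast
  have sym: "(t, s) \<in> double_pairs ?c {0..<1}" if "(s, t) \<in> double_pairs ?c {0..<1}" for s t
    using that by (auto simp: double_pairs_def)
  have inj: "inj_on ?g {0..<1}" using f by (rule inj_on_circle_act)
  define h where "h u v = ({u, v}, chord_parity P {u, v})" for u v
  have PA: "decorated_prechords P = (\<lambda>(s, t). h (?g s) (?g t)) ` A"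
  proof -
    have "(u, v, Precrossing) \<in> P \<longleftrightarrow> (\<exists>s t. (s, t) \<in> A \<and> u = ?g s \<and> v = ?g t)" for u v
      unfolding Pf gauss_of_def A_def by (auto simp: image_Un image_iff split: prod.splits)
    then have "decorated_prechords P = {h u v | u v. \<exists>s t. (s, t) \<in> A \<and> u = ?g s \<and> v = ?g t}"
      unfolding decorated_prechords_def h_def by simp
    also have "\<dots> = (\<lambda>(s, t). h (?g s) (?g t)) ` A"
      by (rule set_eqI) (simp add: image_iff split_beta, metis fst_conv snd_conv prod.collapse)
    finally show ?thesis .
  qed
  let ?X = "decorated_prechords P"
  have finX: "finite ?X" unfolding PA using fin by simp
  have "chord_diagram ?X"
    unfolding chord_diagram_def
  proof (intro conjI)
    show "finite ?X" by (fact finX)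
    have "{?g s, ?g t} \<subseteq> {0..<1} \<and> card {?g s, ?g t} = 2" if "(s, t) \<in> A" for s t
    proof -
      have "s \<in> {0..<1}" "t \<in> {0..<1}" "s \<noteq> t"
        using that A_dbl by (auto simp: double_pairs_def)
      then have "?g s \<noteq> ?g t" using inj by (auto dest: inj_onD)
      then show ?thesis by (simp add: circle_act_def frac_ge_0 frac_lt_1)
    qed
    then show "\<forall>(k, e) \<in> ?X. k \<subseteq> {0..<1} \<and> card k = 2"
      unfolding PA h_def by (auto simp del: insert_subset)
    have "{?g s, ?g t} = {?g u, ?g v}"
      if "(s, t) \<in> A" "(u, v) \<in> A" "{?g s, ?g t} \<inter> {?g u, ?g v} \<noteq> {}" for s t u v
    proof -
      have d: "(s, t) \<in> double_pairs ?c {0..<1}" "(u, v) \<in> double_pairs ?c {0..<1}"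
        using that A_dbl by auto
      have "{s, t, u, v} \<subseteq> {0..<1}" using d by (auto simp: double_pairs_def)
      then have "?g ` ({s, t} \<inter> {u, v}) = ?g ` {s, t} \<inter> ?g ` {u, v}"
        by (intro inj_on_image_Int[OF inj]) auto
      then have "?g ` ({s, t} \<inter> {u, v}) \<noteq> {}" using that(3) by simp
      then have "{s, t} \<inter> {u, v} \<noteq> {}" by blast
      then consider "s = u" | "s = v" | "t = u" | "t = v" by blast
      then show ?thesis
      proof cases
        case 1 then show ?thesis using uniq[of s t v] d by simp
      next
        case 2 then show ?thesis using uniq[of s t u] d(1) sym[OF d(2)] by (simp add: insert_commute)
      next
        case 3 then show ?thesis using uniq[of t s v] d(2) sym[OF d(1)] by (simp add: insert_commute)
      next
        case 4 then show ?thesis using uniq[of t s u] sym[OF d(2)] sym[OF d(1)] by simp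
      qed
    qed
    then have disj: "h (?g s) (?g t) = h (?g u) (?g v) \<or> fst (h (?g s) (?g t)) \<inter> fst (h (?g u) (?g v)) = {}"
      if "(s, t) \<in> A" "(u, v) \<in> A" for s t u v
      using that unfolding h_def fst_conv by metis
    show "\<forall>p \<in> ?X. \<forall>q \<in> ?X. p \<noteq> q \<longrightarrow> fst p \<inter> fst q = {}"
    proof (intro ballI impI)
      fix p q assume pq: "p \<in> ?X" "q \<in> ?X" "p \<noteq> q"
      obtain s t where st: "(s, t) \<in> A" "p = h (?g s) (?g t)" using pq(1) unfolding PA by auto
      obtain u v where uv: "(u, v) \<in> A" "q = h (?g u) (?g v)" using pq(2) unfolding PA by auto
      show "fst p \<inter> fst q = {}" using disj[OF st(1) uv(1)] pq(3) unfolding st(2) uv(2) by simp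
    qed
  qed
  moreover have "chord_diagram Y" if "chord_diagram Z" "Y \<subseteq> Z" for Y Z
    unfolding chord_diagram_def
  proof (intro conjI)
    show "finite Y"
      using that by (auto simp: chord_diagram_def intro: finite_subset)
    show "\<forall>(k, e) \<in> Y. k \<subseteq> {0..<1} \<and> card k = 2"
      using that unfolding chord_diagram_def by (meson bspec ballI subsetD)
    show "\<forall>p \<in> Y. \<forall>q \<in> Y. p \<noteq> q \<longrightarrow> fst p \<inter> fst q = {}"
      using that unfolding chord_diagram_def by (meson subsetD)
  qed
  ultimately have "chord_diagram (reduced ?X)"
    using reduced_subset[OF finX] by blast
  then show ?thesis unfolding I_h_def Z2C_def by blast
qed

end

theory Submission
  imports Defs
begin

text \<open>
  The invariant sees a diagram only through two finite sets of chords, the classical ones and the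
  prechords, without arrows and signs: a prechord is decorated with the parity of the number of
  classical chords that it intersects. It is therefore enough to follow these two sets, up to
  homeomorphism of the circle, through each move. A crossing change alters neither set.

  The strands of a local move are disjoint parameter intervals, and a double point has either both
  preimages on the strands or both outside, because the curve meets the disc exactly along the
  strands. So the chords outside the disc stay as they are, and only a few chords with endpoints on
  prescribed strands change (\<open>local_change_decomposition\<close>). Two facts about chords on a circle then
  carry all moves. First, moving an endpoint within an interval does not affect the intersection
  with chords that have no endpoint there (\<open>chords_intersect_move_endpoint\<close>). Hence for an outer
  prechord, R1 adds a chord that it does not intersect, R2 adds two chords that it intersects both
  or neither, and R3, PR2, PR3 replace chords by chords that it intersects equally. Second,
  exchanging two neighbouring endpoints of two chords toggles whether the chords intersect
  (\<open>chords_intersect_exchange_endpoints\<close>). In PR2 the prechord and the classical chord exchange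
  endpoints on both strands, so their intersection toggles twice. In PR3 the prechord exchanges
  endpoints with each of the two classical chords once, so two intersections toggle and the parity
  is unchanged.

  What remains is bookkeeping about the target. The prechord created by PR1 has decoration \<open>0\<close> and
  adjacent endpoints, so it disappears in the reduction, which is confluent. In PR2 and PR3 the
  prechord itself moves along two strands, which a homeomorphism of the circle supported on these
  strands undoes (\<open>reduced_class_move_chord\<close>). Planar isotopy acts on both chord sets by a
  homeomorphism of the circle, and intersection, adjacency, decoration and reduction are all
  equivariant (\<open>reduced_class_act\<close>).
\<close>

section \<open>Homeomorphisms of the circle\<close>

lemma circle_homeo_add_int:
  assumes "circle_homeo f"
  shows "f (x + of_int n) = f x + of_int n"
proof -
  have nat: "f (y + of_nat m) = f y + of_nat m" for y m
  proof (induction m)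
    case (Suc m)
    have "f ((y + of_nat m) + 1) = f (y + of_nat m) + 1"
      using assms unfolding circle_homeo_def by blast
    then show ?case using Suc by (simp add: algebra_simps)
  qed simp
  show ?thesis
  proof (cases "n \<ge> 0")
    case True
    then show ?thesis using nat[of x "nat n"] by simp
  next
    case False
    then show ?thesis using nat[of "x + of_int n" "nat (- n)"] by simp
  qed
qed

lemma circle_act_frac:
  assumes "circle_homeo f"
  shows "circle_act f (frac x) = circle_act f x"
proof -
  have "f x = f (frac x) + of_int \<lfloor>x\<rfloor>"
    using circle_homeo_add_int[OF assms, of "frac x" "\<lfloor>x\<rfloor>"] by (simp add: frac_def)
  then show ?thesis by (simp add: circle_act_def frac_def)
qed

lemma circle_act_in: "circle_act f x \<in> {0..<1}"
  by (simp add: circle_act_def frac_ge_0 frac_lt_1)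

lemma circle_homeo_comp:
  assumes "circle_homeo f" "circle_homeo g"
  shows "circle_homeo (f \<circ> g)"
  using assms unfolding circle_homeo_def
  by (auto simp: strict_mono_def continuous_on_compose2[of UNIV f UNIV g])

lemma circle_act_comp:
  assumes "circle_homeo f"
  shows "circle_act (f \<circ> g) x = circle_act f (circle_act g x)"
  using circle_act_frac[OF assms, of "g x"] by (simp add: circle_act_def)

text \<open>Continuity comes for free: a monotone surjection cannot jump.\<close>

lemma circle_homeoI:
  assumes "strict_mono f" "surj f" "\<And>x. f (x + 1) = f x + 1"
  shows "circle_homeo f"
proof -
  have "continuous_on UNIV f"
    by (rule continuous_onI_mono) (use assms in \<open>auto simp: strict_mono_less_eq\<close>)
  then show ?thesis using assms by (simp add: circle_homeo_def)
qed

lemma surj_circle_homeo: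
  assumes "circle_homeo f"
  shows "surj f"
  unfolding surj_def
proof
  fix y
  define n where "n = \<lfloor>y - f 0\<rfloor>"
  have "f (of_int n) = f 0 + of_int n" "f (of_int n + 1) = f 0 + of_int n + 1"
    using circle_homeo_add_int[OF assms, of 0 n] circle_homeo_add_int[OF assms, of 0 "n + 1"] by auto
  then have "f (of_int n) \<le> y" "y \<le> f (of_int n + 1)"
    unfolding n_def by linarith+
  moreover have "continuous_on {of_int n .. of_int n + 1} f"
    using assms continuous_on_subset unfolding circle_homeo_def by blast
  ultimately show "\<exists>x. y = f x"
    using IVT'[of f "of_int n" y "of_int n + 1"] by fastforce
qed

lemma circle_homeo_inv:
  assumes "circle_homeo f"
  shows "circle_homeo (inv f)"
proof (rule circle_homeoI)
  have sm: "strict_mono f" and per: "\<And>x. f (x + 1) = f x + 1"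
    using assms by (auto simp: circle_homeo_def)
  have inj: "inj f" using sm by (rule strict_mono_imp_inj_on)
  have surj: "surj f" using assms by (rule surj_circle_homeo)
  show "strict_mono (inv f)"
  proof (rule strict_monoI)
    fix x y :: real assume "x < y"
    then have "f (inv f x) < f (inv f y)" using surj by (simp add: surj_f_inv_f)
    then show "inv f x < inv f y" using sm by (simp add: strict_mono_less)
  qed
  show "surj (inv f)" using inj by (rule inj_imp_surj_inv)
  show "inv f (x + 1) = inv f x + 1" for x
  proof -
    have "f (inv f x + 1) = x + 1" using per surj by (simp add: surj_f_inv_f)
    then show ?thesis using inv_f_f[OF inj] by metis
  qed
qed

lemma circle_act_inv:
  assumes "circle_homeo f" "x \<in> {0..<1}"
  shows "circle_act f (circle_act (inv f) x) = x" "circle_act (inv f) (circle_act f x) = x"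
proof -
  have id: "f (inv f x) = x" "inv f (f x) = x"
    using assms(1) surj_circle_homeo by (auto simp: surj_f_inv_f circle_homeo_def strict_mono_imp_inj_on)
  have "frac x = x" using assms(2) by (simp add: frac_eq)
  then show "circle_act f (circle_act (inv f) x) = x" "circle_act (inv f) (circle_act f x) = x"
    using circle_act_comp[OF assms(1), of "inv f" x]
      circle_act_comp[OF circle_homeo_inv[OF assms(1)], of f x] id
    by (simp_all add: circle_act_def)
qed

lemma circle_act_image:
  assumes "circle_homeo f"
  shows "circle_act f ` {0..<1} = {0..<1}"
proof
  show "circle_act f ` {0..<1} \<subseteq> {0..<1}" by (rule image_subsetI) (rule circle_act_in)
  show "{0..<1} \<subseteq> circle_act f ` {0..<1}"
  proof
    fix x :: real assume "x \<in> {0..<1}"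
    then have "x = circle_act f (circle_act (inv f) x)" using circle_act_inv(1)[OF assms] by simp
    then show "x \<in> circle_act f ` {0..<1}" using circle_act_in by blast
  qed
qed

text \<open>
  Cutting the circle at the base point, every order automorphism of \<open>[0, 1)\<close> extends periodically to
  a homeomorphism. This makes it possible to construct homeomorphisms on the fundamental domain,
  where circular order is just the linear order.
\<close>

lemma circle_homeo_of_order_iso:
  fixes h :: "real \<Rightarrow> real"
  assumes mono: "strict_mono_on {0..<1} h" and im: "h ` {0..<1} = {0..<1}"
  obtains f where "circle_homeo f" "\<And>x. x \<in> {0..<1} \<Longrightarrow> circle_act f x = h x"
proof
  define f where "f x = of_int \<lfloor>x\<rfloor> + h (frac x)" for x
  have fr: "frac x \<in> {0..<1}" for x :: real by (simp add: frac_ge_0 frac_lt_1)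
  have hr: "0 \<le> h (frac x) \<and> h (frac x) < 1" for x
    using im fr[of x] by (metis atLeastLessThan_iff imageI)
  show "circle_homeo f"
  proof (rule circle_homeoI)
    show "strict_mono f"
    proof (rule strict_monoI)
      fix x y :: real assume "x < y"
      show "f x < f y"
      proof (cases "\<lfloor>x\<rfloor> = \<lfloor>y\<rfloor>")
        case True
        then have "frac x < frac y" using \<open>x < y\<close> by (simp add: frac_def)
        then show ?thesis using True mono fr unfolding f_def
          by (simp add: strict_mono_onD)
      next
        case False
        then have "\<lfloor>x\<rfloor> + 1 \<le> \<lfloor>y\<rfloor>" using \<open>x < y\<close> floor_mono[of x y] by linarith
        then show ?thesis using hr[of x] hr[of y] unfolding f_def by linarith
      qed
    qed
    show "surj f"
      unfolding surj_def
    proof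
      fix y
      obtain x where x: "x \<in> {0..<1}" "h x = frac y" using im fr[of y] by (metis imageE)
      have "\<lfloor>x + of_int \<lfloor>y\<rfloor>\<rfloor> = \<lfloor>y\<rfloor>" using x(1) by (simp add: floor_unique)
      then have "f (x + of_int \<lfloor>y\<rfloor>) = y" unfolding f_def using x by (simp add: frac_def)
      then show "\<exists>x. y = f x" by metis
    qed
    show "f (x + 1) = f x + 1" for x by (simp add: f_def frac_def)
  qed
  show "circle_act f x = h x" if "x \<in> {0..<1}" for x
  proof -
    have "\<lfloor>x\<rfloor> = 0" "frac x = x" using that by (simp_all add: floor_unique frac_eq)
    then have "f x = h x" "0 \<le> h x" "h x < 1" using hr[of x] by (simp_all add: f_def)
    then show ?thesis by (simp add: circle_act_def frac_eq)
  qed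
qed

text \<open>
  The piecewise linear map that fixes everything outside the open interval \<open>I\<close> and takes \<open>u\<close> to
  \<open>u'\<close> inside, linear on either side of \<open>u\<close>. Its inverse is the same map with \<open>u\<close> and \<open>u'\<close>
  exchanged.
\<close>

definition stretch :: "strand \<Rightarrow> real \<Rightarrow> real \<Rightarrow> real \<Rightarrow> real" where
  "stretch I u u' x =
     (if x \<notin> inner_params I then x
      else if x \<le> u then fst I + (x - fst I) * ((u' - fst I) / (u - fst I))
      else snd I - (snd I - x) * ((snd I - u') / (snd I - u)))"

lemma stretch_bounds:
  assumes "u \<in> inner_params I" "u' \<in> inner_params I" "x \<in> inner_params I"
  shows "x \<le> u \<Longrightarrow> fst I < stretch I u u' x \<and> stretch I u u' x \<le> u'"
    and "u < x \<Longrightarrow> u' < stretch I u u' x \<and> stretch I u u' x < snd I"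
proof -
  obtain a b where I: "I = (a, b)" by fastforce
  have o: "a < u" "u < b" "a < u'" "u' < b" "a < x" "x < b"
    using assms by (auto simp: I inner_params_def)
  show "fst I < stretch I u u' x \<and> stretch I u u' x \<le> u'" if "x \<le> u"
  proof -
    have "0 < (x - a) / (u - a)" "(x - a) / (u - a) \<le> 1" using o that by auto
    then have "0 < (x - a) / (u - a) * (u' - a)" "(x - a) / (u - a) * (u' - a) \<le> 1 * (u' - a)"
      using o by (auto intro!: mult_pos_pos mult_right_mono simp del: times_divide_eq_left)
    then show ?thesis using o that by (simp add: stretch_def I inner_params_def)
  qed
  show "u' < stretch I u u' x \<and> stretch I u u' x < snd I" if "u < x"
  proof -
    have "0 < (b - x) / (b - u)" "(b - x) / (b - u) < 1" using o that by auto
    then have "0 < (b - x) / (b - u) * (b - u')" "(b - x) / (b - u) * (b - u') < 1 * (b - u')"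
      using o by (auto intro!: mult_pos_pos mult_strict_right_mono simp del: times_divide_eq_left)
    then show ?thesis using o that by (simp add: stretch_def I inner_params_def)
  qed
qed

lemma stretch_inverse:
  assumes "u \<in> inner_params I" "u' \<in> inner_params I"
  shows "stretch I u' u (stretch I u u' x) = x"
proof (cases "x \<in> inner_params I")
  case True
  obtain a b where I: "I = (a, b)" by fastforce
  have o: "a < u" "u < b" "a < u'" "u' < b"
    using assms by (auto simp: I inner_params_def)
  show ?thesis
  proof (cases "x \<le> u")
    case le: True
    have "a < stretch I u u' x" "stretch I u u' x \<le> u'" "stretch I u u' x < b"
      using stretch_bounds(1)[OF assms True le] o by (auto simp: I)
    then have "stretch I u' u (stretch I u u' x) = a + (stretch I u u' x - a) * ((u - a) / (u' - a))"
      by (subst stretch_def) (simp add: I inner_params_def)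
    moreover have "stretch I u u' x - a = (x - a) * ((u' - a) / (u - a))"
      using True le by (simp add: stretch_def I)
    ultimately show ?thesis using o by simp
  next
    case False
    have "a < stretch I u u' x" "\<not> stretch I u u' x \<le> u'" "stretch I u u' x < b"
      using stretch_bounds(2)[OF assms True] False o by (auto simp: I)
    then have "stretch I u' u (stretch I u u' x) = b - (b - stretch I u u' x) * ((b - u) / (b - u'))"
      by (subst stretch_def) (simp add: I inner_params_def)
    moreover have "b - stretch I u u' x = (b - x) * ((b - u') / (b - u))"
      using True False by (simp add: stretch_def I)
    ultimately show ?thesis using o by simp
  qed
qed (simp add: stretch_def)

lemma stretch_less:
  assumes "u \<in> inner_params I" "u' \<in> inner_params I" "x < y"
  shows "stretch I u u' x < stretch I u u' y"
proof -
  obtain a b where I: "I = (a, b)" by fastforce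
  have o: "a < u" "u < b" "a < u'" "u' < b"
    using assms by (auto simp: I inner_params_def)
  have pos: "0 < (u' - a) / (u - a)" "0 < (b - u') / (b - u)" using o by auto
  have in_range: "a < stretch I u u' z" "stretch I u u' z < b" if "a < z" "z < b" for z
    using stretch_bounds[OF assms(1,2), of z] that o by (cases "z \<le> u"; force simp: I inner_params_def)+
  consider "x \<notin> inner_params I" "y \<notin> inner_params I" | "x \<notin> inner_params I" "y \<in> inner_params I"
    | "x \<in> inner_params I" "y \<notin> inner_params I"
    | "x \<in> inner_params I" "y \<in> inner_params I" by blast
  then show ?thesis
  proof cases
    case 1
    then show ?thesis using assms(3) by (simp add: stretch_def)
  next
    case 2
    then show ?thesis using in_range[of y] assms(3) by (simp add: stretch_def[of _ _ _ x] I inner_params_def)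
  next
    case 3
    then show ?thesis using in_range[of x] assms(3) by (simp add: stretch_def[of _ _ _ y] I inner_params_def)
  next
    case 4
    consider "y \<le> u" | "x \<le> u" "u < y" | "u < x" using assms(3) by linarith
    then show ?thesis
    proof cases
      case 1
      then show ?thesis using 4 assms(3) mult_strict_right_mono[OF _ pos(1), of "x - a" "y - a"]
        by (simp add: stretch_def I del: times_divide_eq_right)
    next
      case 2
      then show ?thesis using stretch_bounds[OF assms(1,2)] 4 by force
    next
      case 3
      then show ?thesis using 4 assms(3) mult_strict_right_mono[OF _ pos(2), of "b - y" "b - x"]
        by (simp add: stretch_def I del: times_divide_eq_right)
    qed
  qed
qed

text \<open>
  A point can be pushed along a strand without touching the rest of the circle; this is what
  realizes the displacement of a prechord in a local move.
\<close>

lemma circle_homeo_moving_point: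
  assumes "u \<in> inner_params I" "u' \<in> inner_params I" and I: "0 < fst I" "snd I < 1"
  obtains f where "circle_homeo f" "circle_act f u = u'"
    "\<And>x. x \<in> {0..<1} \<Longrightarrow> x \<notin> strand_params I \<Longrightarrow> circle_act f x = x"
proof -
  have range: "stretch I v v' x \<in> {0..<1}"
    if "x \<in> {0..<1}" "v \<in> inner_params I" "v' \<in> inner_params I" for v v' x
  proof (cases "x \<in> inner_params I")
    case True
    then have "fst I < stretch I v v' x \<and> stretch I v v' x < snd I"
      using stretch_bounds[OF that(2,3) True] that(3) by (cases "x \<le> v") (auto simp: inner_params_def)
    then show ?thesis using I by simp
  next
    case False
    then show ?thesis using that(1) by (simp add: stretch_def)
  qed
  have "strict_mono_on {0..<1} (stretch I u u')"
    using stretch_less[OF assms(1,2)] by (simp add: strict_mono_on_def)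
  moreover have "stretch I u u' ` {0..<1} = {0..<1}"
  proof
    show "{0..<1} \<subseteq> stretch I u u' ` {0..<1}"
      using range[OF _ assms(2,1)] stretch_inverse[OF assms(2,1)] by (metis image_eqI subsetI)
  qed (use range assms in blast)
  ultimately obtain f where f: "circle_homeo f" "\<And>x. x \<in> {0..<1} \<Longrightarrow> circle_act f x = stretch I u u' x"
    using circle_homeo_of_order_iso by blast
  show ?thesis
  proof
    show "circle_homeo f" by fact
    show "circle_act f u = u'"
      using f(2)[of u] assms by (simp add: stretch_def inner_params_def)
    show "circle_act f x = x" if "x \<in> {0..<1}" "x \<notin> strand_params I" for x
      using f(2)[of x] that by (auto simp: stretch_def inner_params_def strand_params_def)
  qed
qed

section \<open>Intersection of chords\<close>

lemma chords_intersect_iff: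
  "chords_intersect {a, b} {c, d} \<longleftrightarrow>
     a < c \<and> c < b \<and> (d < a \<or> b < d) \<or> a < d \<and> d < b \<and> (c < a \<or> b < c) \<or>
     b < c \<and> c < a \<and> (d < b \<or> a < d) \<or> b < d \<and> d < a \<and> (c < b \<or> a < c)"
  unfolding chords_intersect_def doubleton_eq_iff by blast

lemma chords_intersect_commute: "chords_intersect {a, b} {c, d} \<longleftrightarrow> chords_intersect {c, d} {a, b}"
  unfolding chords_intersect_iff by (smt (verit))

lemma not_chords_intersect_degenerate: "\<not> chords_intersect {a} {c, d}"
  using chords_intersect_iff[of a a c d] by auto

text \<open>Whether chords intersect depends only on comparisons of an endpoint of one chord with an endpoint
  of the other, so \<open>v\<close> may lie anywhere.\<close>

lemma chords_intersect_move_endpoint: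
  assumes "u \<in> strand_params I" "u' \<in> strand_params I" "p \<notin> strand_params I" "q \<notin> strand_params I"
  shows "chords_intersect {u, v} {p, q} \<longleftrightarrow> chords_intersect {u', v} {p, q}"
proof -
  have "p < u \<longleftrightarrow> p < u'" "q < u \<longleftrightarrow> q < u'" "u < p \<longleftrightarrow> u' < p" "u < q \<longleftrightarrow> u' < q"
    using assms by (auto simp: strand_params_def)
  then show ?thesis unfolding chords_intersect_iff by simp
qed

text \<open>
  Neighbouring endpoints \<open>u\<close> and \<open>x\<close> of two chords trade places while the other two endpoints stay
  outside the interval where this happens. Exactly one of the two cyclic orders of the four endpoints
  is alternating.
\<close>

lemma chords_intersect_exchange_endpoints:
  assumes "{u, x, u', x'} \<subseteq> strand_params I" "v \<notin> strand_params I" "y \<notin> strand_params I" "v \<noteq> y"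
    and "u \<noteq> x" "u' \<noteq> x'" "u < x \<longleftrightarrow> x' < u'"
  shows "chords_intersect {u', v} {x', y} \<longleftrightarrow> \<not> chords_intersect {u, v} {x, y}"
proof -
  obtain a b where I: "strand_params I = {a..b}" by (rule that) (rule strand_params_def)
  have "a \<le> u" "u \<le> b" "a \<le> u'" "u' \<le> b" "a \<le> x" "x \<le> b" "a \<le> x'" "x' \<le> b"
    "v < a \<or> b < v" "y < a \<or> b < y" "v < y \<or> y < v" "(u < x \<and> x' < u') \<or> (x < u \<and> u' < x')"
    using assms unfolding I by auto
  then show ?thesis unfolding chords_intersect_iff by (smt (verit))
qed

text \<open>
  On the fundamental domain, a homeomorphism of the circle is a monotone map followed by a cut and
  an exchange of the two pieces. The points above the cut (predicate \<open>w\<close>) wrap around and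
  land below all others.
\<close>

lemma circle_act_less_iff:
  assumes "circle_homeo f"
  obtains w where "\<And>x y. x \<le> y \<Longrightarrow> w x \<Longrightarrow> w y"
    "\<And>x y. x \<in> {0..<1} \<Longrightarrow> y \<in> {0..<1} \<Longrightarrow>
       circle_act f x < circle_act f y \<longleftrightarrow> (if w x \<longleftrightarrow> w y then x < y else w x)"
proof
  have sm: "strict_mono f" and per: "\<And>x. f (x + 1) = f x + 1"
    using assms by (auto simp: circle_homeo_def)
  define w where "w x \<longleftrightarrow> \<lfloor>f 0\<rfloor> < \<lfloor>f x\<rfloor>" for x
  show "w y" if "x \<le> y" "w x" for x y
    using that sm floor_mono[of "f x" "f y"] unfolding w_def by (simp add: strict_mono_less_eq)
  show "circle_act f x < circle_act f y \<longleftrightarrow> (if w x \<longleftrightarrow> w y then x < y else w x)"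
    if "x \<in> {0..<1}" "y \<in> {0..<1}" for x y
  proof -
    have b: "f 0 \<le> f z \<and> f z < f 0 + 1" if "z \<in> {0..<1}" for z
      using that per[of 0] sm strict_monoD[OF sm, of z 1] by (auto simp: strict_mono_less_eq)
    have d: "f s < f r + 1" if "r \<in> {0..<1}" "s \<in> {0..<1}" for r s
      using that per[of r] strict_monoD[OF sm, of s "r + 1"] by auto
    have fl: "\<lfloor>f z\<rfloor> = \<lfloor>f 0\<rfloor> + (if w z then 1 else 0)" if "z \<in> {0..<1}" for z
    proof -
      have "\<lfloor>f 0\<rfloor> \<le> \<lfloor>f z\<rfloor>" "\<lfloor>f z\<rfloor> \<le> \<lfloor>f 0\<rfloor> + 1"
        using b[OF that] floor_mono[of "f 0" "f z"] floor_mono[of "f z" "f 0 + 1"] by auto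
      then show ?thesis unfolding w_def by auto
    qed
    show ?thesis
      using fl[OF that(1)] fl[OF that(2)] d[OF that] d[OF that(2,1)] strict_mono_less[OF sm, of x y]
      unfolding circle_act_def frac_def by auto
  qed
qed

lemma chords_intersect_circle_act:
  assumes "circle_homeo f" "{a, b, c, d} \<subseteq> {0..<1}"
  shows "chords_intersect (circle_act f ` {a, b}) (circle_act f ` {c, d}) \<longleftrightarrow> chords_intersect {a, b} {c, d}"
proof -
  obtain w where w: "\<And>x y. x \<le> y \<Longrightarrow> w x \<Longrightarrow> w y"
    "\<And>x y. x \<in> {0..<1} \<Longrightarrow> y \<in> {0..<1} \<Longrightarrow>
       circle_act f x < circle_act f y \<longleftrightarrow> (if w x \<longleftrightarrow> w y then x < y else w x)"
    using circle_act_less_iff[OF assms(1)] by blast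
  have lt: "x < y" if "w y" "\<not> w x" for x y using w(1)[of y x] that by force
  note less = w(2)[OF subsetD[OF assms(2)] subsetD[OF assms(2)]]
  show ?thesis
    using lt[of a b] lt[of a c] lt[of a d] lt[of b a] lt[of b c] lt[of b d]
      lt[of c a] lt[of c b] lt[of c d] lt[of d a] lt[of d b] lt[of d c]
    apply (simp only: image_insert image_empty chords_intersect_iff less insert_iff simp_thms)
    by (smt (verit))
qed

section \<open>Decorated chord diagrams\<close>

definition act :: "(real \<Rightarrow> real) \<Rightarrow> decorated \<Rightarrow> decorated" where
  "act f X = (\<lambda>(k, e). (circle_act f ` k, e)) ` X"

text \<open>The action of a homeomorphism is faithful only on subsets of the fundamental domain.\<close>

definition based :: "decorated \<Rightarrow> bool" where
  "based X \<longleftrightarrow> finite X \<and> (\<forall>(k, e) \<in> X. \<exists>a b. k = {a, b} \<and> a \<noteq> b \<and> {a, b} \<subseteq> {0..<1})"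

lemma based_subset: "based X \<Longrightarrow> Y \<subseteq> X \<Longrightarrow> based Y"
  unfolding based_def by (meson finite_subset subsetD)

lemma based_endpoints: "based X \<Longrightarrow> \<Union>(fst ` X) \<subseteq> {0..<1}"
  unfolding based_def by fastforce

lemma act_act: "circle_homeo f \<Longrightarrow> act f (act g X) = act (f \<circ> g) X"
  by (simp add: act_def image_image split_beta circle_act_comp)

lemma act_inv:
  assumes "circle_homeo f" "based X"
  shows "act (inv f) (act f X) = X"
proof -
  have "circle_act (inv f) ` circle_act f ` fst x = fst x" if "x \<in> X" for x
  proof -
    have "fst x \<subseteq> {0..<1}" using based_endpoints[OF assms(2)] that by blast
    then have "circle_act (inv f) ` circle_act f ` fst x = (\<lambda>y. y) ` fst x"
      unfolding image_comp using circle_act_inv(2)[OF assms(1)] by (intro image_cong) auto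
    then show ?thesis by simp
  qed
  then have "act (inv f) (act f X) = (\<lambda>x. x) ` X"
    unfolding act_def image_comp o_def split_beta fst_conv snd_conv by (intro image_cong refl) simp
  then show ?thesis by simp
qed

lemma chord_class_eq_act: "chord_class X = {act f X | f. circle_homeo f}"
  by (simp add: chord_class_def act_def)

lemma chord_class_act:
  assumes f: "circle_homeo f" and X: "based X"
  shows "chord_class (act f X) = chord_class X"
proof
  show "chord_class (act f X) \<subseteq> chord_class X"
    unfolding chord_class_eq_act using act_act circle_homeo_comp[OF _ f] by fastforce
  show "chord_class X \<subseteq> chord_class (act f X)"
  proof
    fix Y assume "Y \<in> chord_class X"
    then obtain g where g: "circle_homeo g" "Y = act g X" unfolding chord_class_eq_act by blast
    then have "Y = act (g \<circ> inv f) (act f X)"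
      using act_act[OF g(1), of "inv f" "act f X"] act_inv[OF f X] by simp
    then show "Y \<in> chord_class (act f X)"
      unfolding chord_class_eq_act using circle_homeo_comp[OF g(1) circle_homeo_inv[OF f]] by blast
  qed
qed

text \<open>
  Adjacency in terms of intersection: the endpoints of a chord fail to be adjacent iff both arcs
  contain endpoints of the diagram, and then two such endpoints span a chord that intersects the given
  one. Invariance of adjacency thereby reduces to invariance of intersection, with no
  need to know which arc contains the base point.
\<close>

lemma adjacent_endpoints_iff:
  assumes "\<Union>(fst ` X) \<subseteq> {0..<1}" "a \<noteq> b"
  shows "adjacent_endpoints X {a, b} \<longleftrightarrow>
    (\<forall>p \<in> \<Union>(fst ` X). \<forall>q \<in> \<Union>(fst ` X). \<not> chords_intersect {a, b} {p, q})"
proof -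
  define E where "E = \<Union>(fst ` X)"
  have *: "adjacent_endpoints X {a, b} \<longleftrightarrow> (\<forall>p \<in> E. \<forall>q \<in> E. \<not> chords_intersect {a, b} {p, q})"
    if "a < b" for a b
  proof -
    have "adjacent_endpoints X {a, b} \<longleftrightarrow>
        ({a<..<b} \<inter> E = {} \<or> ({0..<1} - {a..b}) \<inter> E = {})"
      unfolding adjacent_endpoints_def E_def[symmetric] doubleton_eq_iff using that by force
    also have "\<dots> \<longleftrightarrow> \<not> (\<exists>p \<in> E. \<exists>q \<in> E. a < p \<and> p < b \<and> (q < a \<or> b < q))"
      using assms(1) unfolding E_def[symmetric] by fastforce
    also have "\<dots> \<longleftrightarrow> (\<forall>p \<in> E. \<forall>q \<in> E. \<not> chords_intersect {a, b} {p, q})"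
      unfolding chords_intersect_iff using that by fastforce
    finally show ?thesis .
  qed
  show ?thesis
    using *[of a b] *[of b a] assms(2) unfolding E_def[symmetric] by (metis insert_commute neqE)
qed

lemma endpoints_act: "\<Union>(fst ` act f X) = circle_act f ` \<Union>(fst ` X)"
  by (force simp: act_def)

lemma adjacent_endpoints_act:
  assumes f: "circle_homeo f" and X: "based X" and k: "(k, e) \<in> X"
  shows "adjacent_endpoints (act f X) (circle_act f ` k) \<longleftrightarrow> adjacent_endpoints X k"
proof -
  obtain a b where ab: "k = {a, b}" "a \<noteq> b" "{a, b} \<subseteq> {0..<1}"
    using X k unfolding based_def by fastforce
  have ne: "circle_act f a \<noteq> circle_act f b"
    using inj_onD[OF inj_on_circle_act[OF f], of a b] ab by auto
  have E: "\<Union>(fst ` X) \<subseteq> {0..<1}" using X by (rule based_endpoints)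
  have E': "\<Union>(fst ` act f X) \<subseteq> {0..<1}" unfolding endpoints_act by (rule image_subsetI) (rule circle_act_in)
  have "chords_intersect (circle_act f ` {a, b}) (circle_act f ` {p, q}) \<longleftrightarrow> chords_intersect {a, b} {p, q}"
    if "p \<in> \<Union>(fst ` X)" "q \<in> \<Union>(fst ` X)" for p q
    by (rule chords_intersect_circle_act[OF f]) (use that E ab in blast)
  then show ?thesis
    unfolding ab(1) adjacent_endpoints_iff[OF E ab(2)] image_insert image_empty
      adjacent_endpoints_iff[OF E' ne] endpoints_act ball_simps by simp
qed

lemma act_delete:
  assumes f: "circle_homeo f" and X: "based X" and k: "(k, e) \<in> X"
  shows "act f (X - {(k, e)}) = act f X - {(circle_act f ` k, e)}"
proof -
  have "inj_on (\<lambda>(k, e). (circle_act f ` k, e)) X"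
  proof (rule inj_onI)
    fix x y assume xy: "x \<in> X" "y \<in> X"
      "(\<lambda>(k, e). (circle_act f ` k, e)) x = (\<lambda>(k, e). (circle_act f ` k, e)) y"
    then have "fst x \<subseteq> {0..<1}" "fst y \<subseteq> {0..<1}" using based_endpoints[OF X] by blast+
    moreover have "circle_act f ` fst x = circle_act f ` fst y" "snd x = snd y"
      using xy(3) by (simp_all add: split_beta)
    ultimately show "x = y"
      using inj_on_image_eq_iff[OF inj_on_circle_act[OF f]] by (simp add: prod_eq_iff)
  qed
  then show ?thesis
    unfolding act_def using k by (subst inj_on_image_set_diff[of _ X]) auto
qed

lemma delete_chord_act:
  assumes f: "circle_homeo f" and X: "based X" and XY: "delete_chord X Y"
  shows "delete_chord (act f X) (act f Y)"
proof -
  obtain k where k: "(k, 0) \<in> X" "adjacent_endpoints X k" "Y = X - {(k, 0)}"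
    using XY by (auto elim: delete_chord.cases)
  have "(circle_act f ` k, 0) \<in> act f X" using k(1) by (force simp: act_def)
  then show ?thesis
    using k adjacent_endpoints_act[OF f X k(1)] act_delete[OF f X k(1)]
    by (simp add: delete_chord.intros)
qed

text \<open>Irreducibility is preserved as well: adjacency is reflected by homeomorphisms, not only
  preserved.\<close>

lemma delete_chord_act_converse:
  assumes f: "circle_homeo f" and X: "based X" and "delete_chord (act f X) Z"
  shows "\<exists>Y. delete_chord X Y"
proof -
  obtain l where l: "(l, 0) \<in> act f X" "adjacent_endpoints (act f X) l"
    using assms(3) by (auto elim: delete_chord.cases)
  obtain k where k: "(k, 0) \<in> X" "l = circle_act f ` k" using l(1) by (auto simp: act_def)
  then show ?thesis
    using l(2) adjacent_endpoints_act[OF f X k(1)] by (auto intro: delete_chord.intros)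
qed

lemma deletions_subset: "delete_chord\<^sup>*\<^sup>* X Y \<Longrightarrow> Y \<subseteq> X"
  by (induction rule: rtranclp_induct) (auto elim: delete_chord.cases)

lemma reduced_eqI:
  assumes "finite X" "fully_reduced X Y"
  shows "reduced X = Y"
  using fully_reduced_unique[OF fully_reduced_reduced[OF assms(1)] assms(2)] .

lemma reduced_act:
  assumes f: "circle_homeo f" and X: "based X"
  shows "reduced (act f X) = act f (reduced X)"
proof (rule reduced_eqI)
  have fin: "finite X" using X by (simp add: based_def)
  then show "finite (act f X)" by (simp add: act_def)
  have r: "delete_chord\<^sup>*\<^sup>* X (reduced X)" "\<nexists>Z. delete_chord (reduced X) Z"
    using fully_reduced_reduced[OF fin] by (auto simp: fully_reduced_def)
  have "delete_chord\<^sup>*\<^sup>* (act f X) (act f Y)" if "delete_chord\<^sup>*\<^sup>* X Y" for Y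
    using that
  proof (induction rule: rtranclp_induct)
    case (step Y Z)
    have "based Y" using X deletions_subset[OF step.hyps(1)] by (rule based_subset)
    then show ?case using delete_chord_act[OF f] step by (meson rtranclp.rtrancl_into_rtrancl)
  qed simp
  moreover have "based (reduced X)" using based_subset[OF X reduced_subset[OF fin]] .
  ultimately show "fully_reduced (act f X) (act f (reduced X))"
    using r delete_chord_act_converse[OF f] unfolding fully_reduced_def by blast
qed

lemma reduced_delete_chord:
  assumes "finite X" "delete_chord X Y"
  shows "reduced X = reduced Y"
proof (rule reduced_eqI)
  have "finite Y" using assms by (auto elim: delete_chord.cases)
  then show "fully_reduced X (reduced Y)"
    using fully_reduced_reduced[of Y] assms(2)
    unfolding fully_reduced_def by (meson converse_rtranclp_into_rtranclp)
qed (fact assms(1))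

definition reduced_class :: "decorated \<Rightarrow> decorated set" where
  "reduced_class X = chord_class (reduced X)"

lemma reduced_class_act:
  assumes "circle_homeo f" "based X"
  shows "reduced_class (act f X) = reduced_class X"
  unfolding reduced_class_def reduced_act[OF assms]
  by (rule chord_class_act[OF assms(1) based_subset[OF assms(2)]])
    (use assms(2) in \<open>simp add: reduced_subset based_def\<close>)

section \<open>The decorated diagram of a pseudodiagram\<close>

definition parity :: "chord set \<Rightarrow> chord \<Rightarrow> bit" where
  "parity C k = (\<Sum>l \<in> C. of_bool (chords_intersect k l))"

definition decorate :: "chord set \<Rightarrow> chord set \<Rightarrow> decorated" where
  "decorate C Q = (\<lambda>k. (k, parity C k)) ` Q"

text \<open>For a local move, \<open>A\<close> is the set of parameters on the strands, and the chords that avoid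
  it are the double points outside the disc.\<close>

definition chord_avoiding :: "real set \<Rightarrow> chord \<Rightarrow> bool" where
  "chord_avoiding A k \<longleftrightarrow> (\<exists>a b. k = {a, b} \<and> a \<noteq> b \<and> {a, b} \<subseteq> {0..<1} - A)"

lemma parity_insert:
  "finite C \<Longrightarrow> l \<notin> C \<Longrightarrow> parity (insert l C) k = of_bool (chords_intersect k l) + parity C k"
  unfolding parity_def by (rule sum.insert)

lemma based_decorate:
  "finite Q \<Longrightarrow> (\<And>k. k \<in> Q \<Longrightarrow> chord_avoiding {} k) \<Longrightarrow> based (decorate C Q)"
  by (auto simp: based_def decorate_def chord_avoiding_def)

lemma decorate_circle_act:
  assumes f: "circle_homeo f"
    and C: "\<And>k. k \<in> C \<Longrightarrow> chord_avoiding {} k" and Q: "\<And>k. k \<in> Q \<Longrightarrow> chord_avoiding {} k"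
  shows "decorate ((`) (circle_act f) ` C) ((`) (circle_act f) ` Q) = act f (decorate C Q)"
proof -
  have "inj_on ((`) (circle_act f)) C"
  proof (rule inj_onI)
    fix k l assume kl: "k \<in> C" "l \<in> C" "circle_act f ` k = circle_act f ` l"
    then have "k \<subseteq> {0..<1}" "l \<subseteq> {0..<1}" using C by (force simp: chord_avoiding_def)+
    then show "k = l" using inj_on_image_eq_iff[OF inj_on_circle_act[OF f]] kl(3) by blast
  qed
  moreover have "chords_intersect (circle_act f ` k) (circle_act f ` l) \<longleftrightarrow> chords_intersect k l"
    if kl: "k \<in> Q" "l \<in> C" for k l
  proof -
    obtain a b c d where "k = {a, b}" "l = {c, d}" "{a, b, c, d} \<subseteq> {0..<1}"
      using C[OF kl(2)] Q[OF kl(1)] unfolding chord_avoiding_def by auto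
    then show ?thesis using chords_intersect_circle_act[OF f] by metis
  qed
  ultimately have "parity ((`) (circle_act f) ` C) (circle_act f ` k) = parity C k" if "k \<in> Q" for k
    using that by (simp add: parity_def sum.reindex)
  then show ?thesis by (auto simp: decorate_def act_def image_image)
qed

definition chords_of :: "(real \<times> real) set \<Rightarrow> chord set" where
  "chords_of R = (\<lambda>(s, t). {s, t}) ` R"

lemma chords_of_simps [simp]:
  "chords_of {} = {}" "chords_of (insert (s, t) R) = insert {s, t} (chords_of R)"
  "chords_of (R \<union> R') = chords_of R \<union> chords_of R'" "chords_of (R\<inverse>) = chords_of R"
  by (force simp: chords_of_def)+

definition decorated_diagram :: "pseudo \<Rightarrow> decorated" where
  "decorated_diagram D = decorate (chords_of (over D)) (chords_of (precrossing_pairs D))"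

lemma pseudodiagram_finite:
  assumes "pseudodiagram D"
  shows "finite (double_pairs (curve D) {0..<1})" "finite (over D)" "finite (precrossing_pairs D)"
  using assms unfolding pseudodiagram_def generic_immersion_def precrossing_pairs_def
  by (auto intro: finite_subset)

lemma double_pairs_chord: "(s, t) \<in> double_pairs c {0..<1} \<Longrightarrow> chord_avoiding {} {s, t}"
  by (auto simp: double_pairs_def chord_avoiding_def)

lemma pseudodiagram_chords:
  assumes "pseudodiagram D"
  shows "k \<in> chords_of (over D) \<Longrightarrow> chord_avoiding {} k"
    and "k \<in> chords_of (precrossing_pairs D) \<Longrightarrow> chord_avoiding {} k"
  using assms double_pairs_chord
  unfolding chords_of_def pseudodiagram_def precrossing_pairs_def by auto

lemma based_decorated_diagram: "pseudodiagram D \<Longrightarrow> based (decorated_diagram D)"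
  unfolding decorated_diagram_def
  by (rule based_decorate) (simp_all add: pseudodiagram_finite chords_of_def pseudodiagram_chords[unfolded chords_of_def])

lemma det2_commute: "det2 v u = - det2 u v"
  by (simp add: det2_def)

lemma setcompr_eq_image_pairs: "{F s t | s t. (s, t) \<in> R} = (\<lambda>(s, t). F s t) ` R"
proof (intro set_eqI iffI)
  fix x assume "x \<in> {F s t | s t. (s, t) \<in> R}"
  then obtain s t where "(s, t) \<in> R" "x = F s t" by blast
  then show "x \<in> (\<lambda>(s, t). F s t) ` R" by (intro image_eqI[of _ _ "(s, t)"]) simp_all
next
  fix x assume "x \<in> (\<lambda>(s, t). F s t) ` R"
  then obtain y where "y \<in> R" "x = (\<lambda>(s, t). F s t) y" by blast
  then show "x \<in> {F s t | s t. (s, t) \<in> R}" by (cases y) auto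
qed

text \<open>The decoration counts arrows, while \<^const>\<open>parity\<close> counts chords; the two agree when
  distinct classical arrows have distinct endpoint sets.\<close>

lemma decorated_prechords_eq_decorate:
  assumes inj: "inj_on (\<lambda>(s, t, l). {s, t}) {(s, t, l) \<in> P. l \<noteq> Precrossing}"
    and fin: "finite P"
  shows "decorated_prechords P =
    decorate ((\<lambda>(s, t, l). {s, t}) ` {(s, t, l) \<in> P. l \<noteq> Precrossing}) (chords_of {(s, t). (s, t, Precrossing) \<in> P})"
proof -
  let ?K = "{(s, t, l) \<in> P. l \<noteq> Precrossing}"
  have "chord_parity P k = parity ((\<lambda>(s, t, l). {s, t}) ` ?K) k" for k
  proof -
    have "parity ((\<lambda>(s, t, l). {s, t}) ` ?K) k = (\<Sum>(s, t, l) \<in> ?K. of_bool (chords_intersect k {s, t}))"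
      unfolding parity_def by (subst sum.reindex[OF inj]) (simp add: split_beta)
    also have "\<dots> = of_nat (card {x \<in> ?K. case x of (s, t, l) \<Rightarrow> chords_intersect k {s, t}})"
    proof -
      have "finite ?K" using fin by (rule finite_subset[rotated]) auto
      then show ?thesis by (simp add: split_beta Int_def sum_of_bool_eq del: Collect_case_prod)
    qed
    also have "{x \<in> ?K. case x of (s, t, l) \<Rightarrow> chords_intersect k {s, t}} =
        {(s, t, l) \<in> P. l \<noteq> Precrossing \<and> chords_intersect k {s, t}}" by auto
    finally show ?thesis unfolding chord_parity_def by simp
  qed
  then show ?thesis
    using setcompr_eq_image_pairs[of "\<lambda>s t. ({s, t}, chord_parity P {s, t})" "{(s, t). (s, t, Precrossing) \<in> P}"]
    by (simp add: decorated_prechords_def decorate_def chords_of_def image_image split_beta)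
qed

text \<open>
  Every precrossing contributes exactly one arrow to the Gauss diagram, since transversality makes
  exactly one order of its two strands positively oriented. Classical arrows are determined by their
  chords because at a crossing only one of the strands is over. Hence forgetting directions loses and
  identifies nothing.
\<close>

lemma decorated_prechords_gauss_diagram:
  assumes D: "pseudodiagram D" and f: "circle_homeo f"
    and P: "P = (\<lambda>(s, t, l). (circle_act f s, circle_act f t, l)) ` gauss_of D"
  shows "decorated_prechords P = act f (decorated_diagram D)"
proof -
  define g where "g = circle_act f"
  define sgn where "sgn s t = (if det2 (velocity (curve D) s) (velocity (curve D) t) > 0 then 1 else - 1 :: int)" for s t
  define pos where "pos = {(s, t) \<in> precrossing_pairs D. det2 (velocity (curve D) s) (velocity (curve D) t) > 0}"
  have over: "over D \<subseteq> double_pairs (curve D) {0..<1}" "\<And>s t. (s, t) \<in> over D \<Longrightarrow> (t, s) \<notin> over D"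
    using D unfolding pseudodiagram_def by auto
  have "gauss_of D = {(s, t, Classical (sgn s t)) | s t. (s, t) \<in> over D} \<union>
      {(s, t, Precrossing) | s t. (s, t) \<in> pos}"
    unfolding gauss_of_def sgn_def pos_def by simp
  then have P': "P = (\<lambda>(s, t). (g s, g t, Classical (sgn s t))) ` over D \<union>
      (\<lambda>(s, t). (g s, g t, Precrossing)) ` pos"
    unfolding P g_def setcompr_eq_image_pairs by (simp add: image_Un image_image split_beta)
  have cl: "{(s, t, l) \<in> P. l \<noteq> Precrossing} = (\<lambda>(s, t). (g s, g t, Classical (sgn s t))) ` over D"
    unfolding P' by auto
  have pre: "{(s, t). (s, t, Precrossing) \<in> P} = (\<lambda>(s, t). (g s, g t)) ` pos"
    unfolding P' by auto
  have inj: "inj_on (\<lambda>(s, t, l). {s, t}) {(s, t, l) \<in> P. l \<noteq> Precrossing}"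
    unfolding cl
  proof (rule inj_onI)
    fix x y
    assume "x \<in> (\<lambda>(s, t). (g s, g t, Classical (sgn s t))) ` over D"
      and "y \<in> (\<lambda>(s, t). (g s, g t, Classical (sgn s t))) ` over D"
      and eq: "(\<lambda>(s, t, l). {s, t}) x = (\<lambda>(s, t, l). {s, t}) y"
    then obtain s t s' t' where st: "(s, t) \<in> over D" "(s', t') \<in> over D"
      and xy: "x = (g s, g t, Classical (sgn s t))" "y = (g s', g t', Classical (sgn s' t'))" by auto
    have "g ` {s, t} = g ` {s', t'}" using eq by (simp add: xy)
    moreover have "{s, t} \<subseteq> {0..<1}" "{s', t'} \<subseteq> {0..<1}"
      using st over(1) by (auto simp: double_pairs_def)
    ultimately have "{s, t} = {s', t'}"
      using inj_on_image_eq_iff[OF inj_on_circle_act[OF f]] unfolding g_def by blast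
    then have "s = s' \<and> t = t'" using st over(2) by (auto simp: doubleton_eq_iff)
    then show "x = y" by (simp add: xy)
  qed
  have "finite pos" using pseudodiagram_finite(3)[OF D] by (rule finite_subset[rotated]) (auto simp: pos_def)
  then have fin: "finite P" unfolding P' using pseudodiagram_finite(2)[OF D] by simp
  have "(\<lambda>(s, t, l). {s, t}) ` {(s, t, l) \<in> P. l \<noteq> Precrossing} = (`) g ` chords_of (over D)"
    unfolding cl chords_of_def by (simp add: image_image split_beta)
  moreover have "chords_of {(s, t). (s, t, Precrossing) \<in> P} = (`) g ` chords_of pos"
    unfolding pre chords_of_def by (simp add: image_image split_beta)
  moreover have "chords_of pos = chords_of (precrossing_pairs D)"
  proof -
    have "(s, t) \<in> pos \<or> (t, s) \<in> pos" if "(s, t) \<in> precrossing_pairs D" for s t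
    proof -
      have "(s, t) \<in> double_pairs (curve D) {0..<1}" using that by (simp add: precrossing_pairs_def)
      then have "det2 (velocity (curve D) s) (velocity (curve D) t) \<noteq> 0"
        using D unfolding pseudodiagram_def generic_immersion_def by blast
      moreover have "(t, s) \<in> precrossing_pairs D"
        using that by (auto simp: precrossing_pairs_def double_pairs_def)
      ultimately show ?thesis using that det2_commute[of "velocity (curve D) t" "velocity (curve D) s"]
        by (auto simp: pos_def)
    qed
    then have "precrossing_pairs D \<subseteq> pos \<union> pos\<inverse>" "pos \<subseteq> precrossing_pairs D" by (auto simp: pos_def)
    then have "chords_of (precrossing_pairs D) \<subseteq> chords_of (pos \<union> pos\<inverse>)"
      "chords_of pos \<subseteq> chords_of (precrossing_pairs D)"
      unfolding chords_of_def by (simp_all only: image_mono)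
    then show ?thesis by simp
  qed
  ultimately have "decorated_prechords P = decorate ((`) g ` chords_of (over D)) ((`) g ` chords_of (precrossing_pairs D))"
    using decorated_prechords_eq_decorate[OF inj fin] by simp
  then show ?thesis
    using decorate_circle_act[OF f pseudodiagram_chords[OF D]] by (simp add: g_def decorated_diagram_def)
qed

lemma I_h_gauss_diagram:
  assumes "pseudodiagram D" "is_gauss_diagram P D"
  shows "I_h P = reduced_class (decorated_diagram D)"
proof -
  obtain f where "circle_homeo f" "decorated_prechords P = act f (decorated_diagram D)"
    using assms decorated_prechords_gauss_diagram unfolding is_gauss_diagram_def by blast
  then show ?thesis
    using reduced_class_act based_decorated_diagram[OF assms(1)]
    by (simp add: I_h_def reduced_class_def)
qed

section \<open>Planar isotopies and crossing changes\<close>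

text \<open>A crossing change only reverses the direction of an arrow and its sign.\<close>

lemma crossing_change_invariant:
  assumes "crossing_change D D'"
  shows "decorated_diagram D' = decorated_diagram D"
proof -
  obtain s t where st: "(s, t) \<in> over D" "over D' = insert (t, s) (over D - {(s, t)})"
    and c: "curve D' = curve D"
    using assms unfolding crossing_change_def by blast
  define R where "R = over D - {(s, t)}"
  have R: "over D = insert (s, t) R" "over D' = insert (t, s) R" using st unfolding R_def by auto
  have "chords_of (over D') = chords_of (over D)" by (simp add: R insert_commute)
  moreover have "over D' \<union> (over D')\<inverse> = over D \<union> (over D)\<inverse>" unfolding R by auto
  ultimately show ?thesis
    unfolding decorated_diagram_def precrossing_pairs_def c by simp
qed

text \<open>
  The final map of an ambient isotopy is injective, so it has no influence on which parameters form
  double points; only the reparametrization acts on the chords.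
\<close>

lemma planar_isotopy_invariant:
  assumes D: "pseudodiagram D" "pseudodiagram D'" and iso: "planar_isotopy D D'"
  shows "reduced_class (decorated_diagram D) = reduced_class (decorated_diagram D')"
proof -
  obtain H f where H: "ambient_isotopy H" and f: "circle_homeo f"
    and c: "\<And>t. curve D' t = H 1 (curve D (f t))"
    and o: "over D' = {(s, t). s \<in> {0..<1} \<and> t \<in> {0..<1} \<and> (circle_act f s, circle_act f t) \<in> over D}"
    using iso unfolding planar_isotopy_def by blast
  define g where "g = circle_act f"
  have inj: "inj (H 1)"
  proof -
    obtain G where "homeomorphism UNIV UNIV (H 1) G" using H unfolding ambient_isotopy_def by force
    then show ?thesis by (metis homeomorphism_apply1 injI iso_tuple_UNIV_I)
  qed
  have per: "curve D (frac x) = curve D x" for x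
  proof -
    have step: "curve D (y + 1) = curve D y" for y
      using D(1) unfolding pseudodiagram_def generic_immersion_def by blast
    have nat: "curve D (y + of_nat n) = curve D y" for y n
    proof (induction n)
      case (Suc n)
      then show ?case using step[of "y + of_nat n"] by (simp add: algebra_simps)
    qed simp
    show ?thesis
    proof (cases "\<lfloor>x\<rfloor> \<ge> 0")
      case True
      then show ?thesis using nat[of "frac x" "nat \<lfloor>x\<rfloor>"] by (simp add: frac_def)
    next
      case False
      then show ?thesis using nat[of x "nat (- \<lfloor>x\<rfloor>)"] by (simp add: frac_def)
    qed
  qed
  have dbl: "(s, t) \<in> double_pairs (curve D') {0..<1} \<longleftrightarrow>
      s \<in> {0..<1} \<and> t \<in> {0..<1} \<and> (g s, g t) \<in> double_pairs (curve D) {0..<1}" for s t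
  proof -
    have "curve D (g s) = curve D (f s)" for s by (simp add: g_def circle_act_def per)
    then have "curve D' s = curve D' t \<longleftrightarrow> curve D (g s) = curve D (g t)"
      using inj by (simp add: c inj_eq)
    moreover have "s \<in> {0..<1} \<Longrightarrow> t \<in> {0..<1} \<Longrightarrow> g s = g t \<longleftrightarrow> s = t"
      using inj_on_circle_act[OF f] by (auto simp: g_def inj_on_def)
    ultimately show ?thesis using circle_act_in[of f] by (auto simp: double_pairs_def g_def)
  qed
  \<comment> \<open>Surjectivity of the reparametrization on the circle: no chord is lost by pulling back.\<close>
  have chords: "chords_of R = (`) g ` chords_of {(s, t). s \<in> {0..<1} \<and> t \<in> {0..<1} \<and> (g s, g t) \<in> R}"
    if R: "R \<subseteq> {0..<1} \<times> {0..<1}" for R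
  proof -
    have "R = (\<lambda>(s, t). (g s, g t)) ` {(s, t). s \<in> {0..<1} \<and> t \<in> {0..<1} \<and> (g s, g t) \<in> R}"
    proof (intro set_eqI iffI)
      fix x assume "x \<in> R"
      moreover obtain a b where "x = (a, b)" by fastforce
      moreover have "a \<in> g ` {0..<1}" "b \<in> g ` {0..<1}"
        using calculation R circle_act_image[OF f] by (auto simp: g_def)
      ultimately show "x \<in> (\<lambda>(s, t). (g s, g t)) ` {(s, t). s \<in> {0..<1} \<and> t \<in> {0..<1} \<and> (g s, g t) \<in> R}"
        by force
    qed auto
    then have "chords_of R = chords_of \<dots>" by (rule arg_cong)
    then show ?thesis by (simp add: chords_of_def image_image split_beta)
  qed
  have over: "chords_of (over D) = (`) g ` chords_of (over D')"
    unfolding o g_def[symmetric] using D(1)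
    by (intro chords) (auto simp: pseudodiagram_def double_pairs_def)
  have "precrossing_pairs D' =
      {(s, t). s \<in> {0..<1} \<and> t \<in> {0..<1} \<and> (g s, g t) \<in> precrossing_pairs D}"
    unfolding precrossing_pairs_def using dbl o by (auto simp: g_def)
  moreover have "precrossing_pairs D \<subseteq> {0..<1} \<times> {0..<1}"
    by (auto simp: precrossing_pairs_def double_pairs_def)
  ultimately have "chords_of (precrossing_pairs D) = (`) g ` chords_of (precrossing_pairs D')"
    using chords[of "precrossing_pairs D"] by (simp only:)
  then have "decorated_diagram D = act f (decorated_diagram D')"
    unfolding decorated_diagram_def
    using over decorate_circle_act[OF f pseudodiagram_chords[OF D(2)]] by (simp add: g_def)
  then show ?thesis using reduced_class_act[OF f based_decorated_diagram[OF D(2)]] by simp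
qed

section \<open>Local moves\<close>

lemma local_change_strands:
  assumes "local_change D D' S" "I \<in> set S"
  shows "0 < fst I" "fst I < snd I" "snd I < 1"
  using assms unfolding local_change_def meets_disc_in_def by fastforce+

lemma local_change_disjoint:
  assumes "local_change D D' S"
  shows "sorted_wrt (\<lambda>I J. strand_params I \<inter> strand_params J = {}) S"
  using assms unfolding local_change_def meets_disc_in_def by blast

lemma inner_paramsD: "x \<in> inner_params I \<Longrightarrow> x \<in> strand_params I"
  by (auto simp: inner_params_def strand_params_def)

lemma chords_of_mono: "R \<subseteq> R' \<Longrightarrow> chords_of R \<subseteq> chords_of R'"
  unfolding chords_of_def by (rule image_mono)

text \<open>The two preimages of a double point lie both inside or both outside the disc.\<close>

lemma meets_disc_in_double_pairs:
  assumes "meets_disc_in c B S"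
  shows "double_pairs c {0..<1} =
    double_pairs c ({0..<1} - all_params S) \<union> double_pairs c (all_params S)"
proof -
  have "{t \<in> {0..<1}. c t \<in> B} = all_params S"
    using assms unfolding meets_disc_in_def by blast
  then have A: "t \<in> all_params S \<longleftrightarrow> t \<in> {0..<1} \<and> c t \<in> B" for t by blast
  have "(s, t) \<in> double_pairs c {0..<1} \<longleftrightarrow> (s, t) \<in> double_pairs c ({0..<1} - all_params S)
      \<or> (s, t) \<in> double_pairs c (all_params S)" for s t
    unfolding double_pairs_def mem_Collect_eq prod.case Diff_iff A by (cases "c s = c t") auto
  then show ?thesis by (auto simp only: Un_iff)
qed

text \<open>
  Both diagrams of a local move have the same classical chords \<open>C\<close> and prechords \<open>Q\<close> away from the
  strands. On the strands, the prechords come from the double points \<open>X\<close> of the tangle that carry no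
  over/under information.
\<close>

lemma local_change_decomposition:
  assumes D: "pseudodiagram D" "pseudodiagram D'" and loc: "local_change D D' S"
    and tang: "tangle D S X V" "tangle D' S X' V'"
  obtains C Q where "finite C" "finite Q"
    "\<And>k. k \<in> C \<union> Q \<Longrightarrow> chord_avoiding (all_params S) k"
    "chords_of (over D) = C \<union> chords_of V" "chords_of (over D') = C \<union> chords_of V'"
    "chords_of (precrossing_pairs D) = Q \<union> chords_of (X - (V \<union> V\<inverse>))"
    "chords_of (precrossing_pairs D') = Q \<union> chords_of (X' - (V' \<union> V'\<inverse>))"
proof -
  define A where "A = all_params S"
  define E where "E = double_pairs (curve D) ({0..<1} - A)"
  obtain B where B: "meets_disc_in (curve D) B S" "meets_disc_in (curve D') B S"
    and c: "\<And>t. t \<in> {0..<1} - A \<Longrightarrow> curve D t = curve D' t"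
    and o: "over D - A \<times> A = over D' - A \<times> A"
    using loc unfolding local_change_def A_def by blast
  have E': "E = double_pairs (curve D') ({0..<1} - A)"
    unfolding E_def double_pairs_def using c by auto
  have EA: "E \<inter> A \<times> A = {}" by (auto simp: E_def double_pairs_def)
  define W where "W = over D - A \<times> A"
  \<comment> \<open>The argument is the same for both diagrams, since \<open>E\<close> and \<open>W\<close> can be computed from either.\<close>
  have split: "over F = W \<union> U \<and> precrossing_pairs F = (E - (W \<union> W\<inverse>)) \<union> ((Y - (U \<union> U\<inverse>)) \<union> (Y - (U \<union> U\<inverse>))\<inverse>) \<and> W \<subseteq> E"
    if F: "pseudodiagram F" "meets_disc_in (curve F) B S" "tangle F S Y U"
      "E = double_pairs (curve F) ({0..<1} - A)" "W = over F - A \<times> A" for F Y U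
  proof -
    have d: "double_pairs (curve F) {0..<1} = E \<union> (Y \<union> Y\<inverse>)" and U: "U = over F \<inter> A \<times> A"
      using meets_disc_in_double_pairs[OF F(2)] F(3,4) by (auto simp: tangle_def A_def)
    have YA: "Y \<union> Y\<inverse> \<subseteq> A \<times> A" using F(3) by (auto simp: tangle_def A_def double_pairs_def)
    have "over F \<subseteq> E \<union> (Y \<union> Y\<inverse>)" using F(1) d by (auto simp: pseudodiagram_def)
    then have "W \<subseteq> E" using F(5) YA by auto
    moreover have "over F = W \<union> U" using F(5) U by auto
    moreover have "precrossing_pairs F = (E \<union> (Y \<union> Y\<inverse>)) - ((W \<union> W\<inverse>) \<union> (U \<union> U\<inverse>))"
      unfolding precrossing_pairs_def d \<open>over F = W \<union> U\<close> by auto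
    moreover have "(W \<union> W\<inverse>) \<inter> A \<times> A = {}" using \<open>W \<subseteq> E\<close> EA by auto
    moreover have "U \<union> U\<inverse> \<subseteq> A \<times> A" using U by auto
    ultimately show ?thesis using YA EA by auto
  qed
  have s: "over D = W \<union> V \<and> precrossing_pairs D = (E - (W \<union> W\<inverse>)) \<union> ((X - (V \<union> V\<inverse>)) \<union> (X - (V \<union> V\<inverse>))\<inverse>) \<and> W \<subseteq> E"
    by (rule split) (use D B tang in \<open>simp_all add: E_def W_def\<close>)
  have s': "over D' = W \<union> V' \<and> precrossing_pairs D' = (E - (W \<union> W\<inverse>)) \<union> ((X' - (V' \<union> V'\<inverse>)) \<union> (X' - (V' \<union> V'\<inverse>))\<inverse>) \<and> W \<subseteq> E"
    by (rule split) (use D B tang o in \<open>simp_all add: E' W_def\<close>)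
  have "finite E"
    using pseudodiagram_finite(1)[OF D(1)] unfolding E_def
    by (rule finite_subset[rotated]) (auto simp: double_pairs_def)
  show ?thesis
  proof (rule that[of "chords_of W" "chords_of (E - (W \<union> W\<inverse>))"])
    have "W \<subseteq> E" using s by blast
    then have "finite W" using \<open>finite E\<close> by (rule finite_subset)
    then show "finite (chords_of W)" unfolding chords_of_def by (rule finite_imageI)
    show "finite (chords_of (E - (W \<union> W\<inverse>)))"
      unfolding chords_of_def using \<open>finite E\<close> by (intro finite_imageI finite_Diff)
    show "chord_avoiding (all_params S) k" if "k \<in> chords_of W \<union> chords_of (E - (W \<union> W\<inverse>))" for k
    proof -
      have "k \<in> chords_of E"
        using that chords_of_mono[OF \<open>W \<subseteq> E\<close>] chords_of_mono[of "E - (W \<union> W\<inverse>)" E] by blast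
      then obtain p q where pq: "(p, q) \<in> E" "k = {p, q}" by (auto simp: chords_of_def)
      then have "p \<noteq> q" "{p, q} \<subseteq> {0..<1} - all_params S"
        by (auto simp: E_def A_def double_pairs_def)
      then show ?thesis unfolding pq(2) chord_avoiding_def by blast
    qed
    show "chords_of (over D) = chords_of W \<union> chords_of V" using s by simp
    show "chords_of (over D') = chords_of W \<union> chords_of V'" using s' by simp
    show "chords_of (precrossing_pairs D) = chords_of (E - (W \<union> W\<inverse>)) \<union> chords_of (X - (V \<union> V\<inverse>))"
      using s by (simp only: chords_of_simps Un_absorb)
    show "chords_of (precrossing_pairs D') = chords_of (E - (W \<union> W\<inverse>)) \<union> chords_of (X' - (V' \<union> V'\<inverse>))"
      using s' by (simp only: chords_of_simps Un_absorb)
  qed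
qed

lemma chord_avoiding_neq: "chord_avoiding A k \<Longrightarrow> s \<in> A \<Longrightarrow> k \<noteq> {s, t}"
  by (auto simp: chord_avoiding_def doubleton_eq_iff)

text \<open>For a chord outside the disc it only matters which strands an inner chord connects.\<close>

lemma outer_chord_intersect:
  assumes k: "chord_avoiding A k" and I: "strand_params I \<subseteq> A" "u \<in> strand_params I" "u' \<in> strand_params I"
    and J: "strand_params J \<subseteq> A" "v \<in> strand_params J" "v' \<in> strand_params J"
  shows "chords_intersect k {u, v} \<longleftrightarrow> chords_intersect k {u', v'}"
    and "chords_intersect {u, v} k \<longleftrightarrow> chords_intersect {u', v'} k"
proof -
  obtain p q where k': "k = {p, q}" "p \<notin> A" "q \<notin> A" using k by (auto simp: chord_avoiding_def)
  have "chords_intersect {u, v} k \<longleftrightarrow> chords_intersect {u', v} k"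
    unfolding k' by (rule chords_intersect_move_endpoint[OF I(2,3)]) (use k' I in auto)
  also have "\<dots> \<longleftrightarrow> chords_intersect {v, u'} k" by (simp add: insert_commute)
  also have "\<dots> \<longleftrightarrow> chords_intersect {v', u'} k"
    unfolding k' by (rule chords_intersect_move_endpoint[OF J(2,3)]) (use k' J in auto)
  finally show "chords_intersect {u, v} k \<longleftrightarrow> chords_intersect {u', v'} k" by (simp add: insert_commute)
  then show "chords_intersect k {u, v} \<longleftrightarrow> chords_intersect k {u', v'}"
    unfolding k' using chords_intersect_commute by metis
qed

text \<open>A chord with both endpoints on one strand can be shrunk to a point.\<close>

lemma outer_chord_not_intersect:
  assumes k: "chord_avoiding A k" and I: "strand_params I \<subseteq> A" "u \<in> strand_params I" "v \<in> strand_params I"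
  shows "\<not> chords_intersect k {u, v}" "\<not> chords_intersect {u, v} k"
proof -
  obtain p q where "k = {p, q}" using k by (auto simp: chord_avoiding_def)
  then have "\<not> chords_intersect {v, v} k" "\<not> chords_intersect k {v, v}"
    using not_chords_intersect_degenerate chords_intersect_commute[of p q v v] by auto
  then show "\<not> chords_intersect k {u, v}" "\<not> chords_intersect {u, v} k"
    using outer_chord_intersect[OF k I(1,2,3) I(1,3,3)] by auto
qed

lemma parity_outer:
  assumes "finite C" "\<And>l. l \<in> C \<Longrightarrow> chord_avoiding A l" "s \<in> A"
  shows "parity (insert {s, t} C) k = of_bool (chords_intersect k {s, t}) + parity C k"
  using assms chord_avoiding_neq[of A _ s t] by (intro parity_insert) auto

lemma parity_cong:
  assumes "\<And>l. l \<in> C \<Longrightarrow> chords_intersect k l \<longleftrightarrow> chords_intersect k' l"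
  shows "parity C k = parity C k'"
  using assms unfolding parity_def by (intro sum.cong) auto

text \<open>The chord of a kink has both endpoints on one strand, so it intersects no prechord.\<close>

lemma R1_invariant:
  assumes D: "pseudodiagram D" "pseudodiagram D'" and move: "R1_move D D'"
  shows "decorated_diagram D = decorated_diagram D'"
proof -
  obtain I s t where loc: "local_change D D' [I]" and st: "s \<in> inner_params I" "t \<in> inner_params I"
    and tang: "tangle D [I] {} {}" "tangle D' [I] {(s, t)} {(s, t)}"
    using move unfolding R1_move_def by blast
  obtain C Q where CQ: "finite C" "\<And>k. k \<in> C \<union> Q \<Longrightarrow> chord_avoiding (all_params [I]) k"
    and ch: "chords_of (over D) = C" "chords_of (over D') = insert {s, t} C"
      "chords_of (precrossing_pairs D) = Q" "chords_of (precrossing_pairs D') = Q"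
    by (rule local_change_decomposition[OF D loc tang]) simp
  have A: "strand_params I \<subseteq> all_params [I]" by (simp add: all_params_def)
  have st': "s \<in> strand_params I" "t \<in> strand_params I" using st inner_paramsD by blast+
  have "parity (insert {s, t} C) k = parity C k" if "k \<in> Q" for k
    using parity_outer[OF CQ(1), of "all_params [I]" s t k] CQ(2) that A st'
      outer_chord_not_intersect(1)[of "all_params [I]" k I s t] by auto
  then show ?thesis unfolding decorated_diagram_def ch decorate_def by auto
qed

text \<open>
  The new prechord intersects nothing, so its decoration is \<open>0\<close>, and one of its arcs lies within the
  strand and is free of other endpoints. Deleting it is therefore a legal reduction step, and
  reductions may start with any such step.
\<close>

lemma PR1_invariant:
  assumes D: "pseudodiagram D" "pseudodiagram D'" and move: "PR1_move D D'"
  shows "reduced_class (decorated_diagram D) = reduced_class (decorated_diagram D')"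
proof -
  obtain I s t where loc: "local_change D D' [I]" and st: "s \<in> inner_params I" "t \<in> inner_params I"
    and tang: "tangle D [I] {} {}" "tangle D' [I] {(s, t)} {}"
    using move unfolding PR1_move_def by blast
  obtain C Q where CQ: "finite C" "finite Q" "\<And>k. k \<in> C \<union> Q \<Longrightarrow> chord_avoiding (all_params [I]) k"
    and ch: "chords_of (over D) = C" "chords_of (over D') = C"
      "chords_of (precrossing_pairs D) = Q" "chords_of (precrossing_pairs D') = insert {s, t} Q"
    by (rule local_change_decomposition[OF D loc tang]) simp
  have A: "all_params [I] = strand_params I" by (simp add: all_params_def)
  have st': "s \<in> strand_params I" "t \<in> strand_params I" using st inner_paramsD by blast+
  have avoid: "k \<inter> strand_params I = {}" if "k \<in> C \<union> Q" for k
    using CQ(3)[OF that] unfolding A chord_avoiding_def by auto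
  have par: "parity C {s, t} = 0"
    unfolding parity_def using outer_chord_not_intersect(2)[of "strand_params I" _ I s t] CQ(3) A st'
    by (intro sum.neutral) auto
  have notin: "({s, t}, 0) \<notin> decorate C Q"
    using avoid[of "{s, t}"] st' by (auto simp: decorate_def)
  have diag: "decorated_diagram D' = insert ({s, t}, 0) (decorated_diagram D)"
    unfolding decorated_diagram_def ch by (simp add: decorate_def par)
  have "s \<noteq> t" using tang(2) by (auto simp: tangle_def double_pairs_def)
  \<comment> \<open>The endpoints may come in either order along the strand.\<close>
  have "adjacent_endpoints (insert ({s, t}, 0) (decorate C Q)) {s, t}"
  proof -
    have "\<Union>(fst ` decorate C Q) \<inter> strand_params I = {}" using avoid by (auto simp: decorate_def)
    moreover have "{min s t<..<max s t} \<subseteq> strand_params I"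
      using st' by (auto simp: strand_params_def)
    ultimately have "{min s t<..<max s t} \<inter> \<Union>(fst ` insert ({s, t}, 0) (decorate C Q)) = {}" by auto
    moreover have "{s, t} = {min s t, max s t}" "min s t < max s t" using \<open>s \<noteq> t\<close> by auto
    ultimately show ?thesis unfolding adjacent_endpoints_def by blast
  qed
  then have "delete_chord (decorated_diagram D') (decorated_diagram D' - {({s, t}, 0)})"
    unfolding diag by (intro delete_chord.intros) (simp_all add: decorated_diagram_def ch)
  moreover have "decorated_diagram D' - {({s, t}, 0)} = decorated_diagram D"
    unfolding diag using notin by (simp add: decorated_diagram_def ch)
  moreover have "finite (decorated_diagram D')" unfolding decorated_diagram_def ch using CQ(2) by (simp add: decorate_def)
  ultimately show ?thesis unfolding reduced_class_def using reduced_delete_chord by metis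
qed

text \<open>The two new classical chords connect the same two strands, so each prechord intersects both or
  neither.\<close>

lemma R2_invariant:
  assumes D: "pseudodiagram D" "pseudodiagram D'" and move: "R2_move D D'"
  shows "decorated_diagram D = decorated_diagram D'"
proof -
  obtain I J x1 x2 y1 y2 where loc: "local_change D D' [I, J]"
    and xy: "x1 \<in> inner_params I" "y1 \<in> inner_params I" "x1 \<noteq> y1"
      "x2 \<in> inner_params J" "y2 \<in> inner_params J" "x2 \<noteq> y2"
    and tang: "tangle D [I, J] {} {}" "tangle D' [I, J] {(x1, x2), (y1, y2)} {(x1, x2), (y1, y2)}"
    using move unfolding R2_move_def by blast
  define A where "A = all_params [I, J]"
  obtain C Q where CQ: "finite C" "\<And>k. k \<in> C \<union> Q \<Longrightarrow> chord_avoiding A k"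
    and ch: "chords_of (over D) = C" "chords_of (over D') = insert {x1, x2} (insert {y1, y2} C)"
      "chords_of (precrossing_pairs D) = Q" "chords_of (precrossing_pairs D') = Q"
    by (rule local_change_decomposition[OF D loc tang]) (simp add: A_def insert_commute)
  have A: "strand_params I \<subseteq> A" "strand_params J \<subseteq> A" by (auto simp: A_def all_params_def)
  have disj: "strand_params I \<inter> strand_params J = {}" using local_change_disjoint[OF loc] by simp
  have xy': "x1 \<in> strand_params I" "y1 \<in> strand_params I" "x2 \<in> strand_params J" "y2 \<in> strand_params J"
    using xy inner_paramsD by blast+
  have "x1 \<noteq> y2" using xy' disj by auto
  then have ne: "{x1, x2} \<notin> insert {y1, y2} C"
    using xy(3) chord_avoiding_neq[of A _ x1 x2] CQ(2) xy' A by (auto simp: doubleton_eq_iff)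
  have "parity (insert {x1, x2} (insert {y1, y2} C)) k = parity C k" if "k \<in> Q" for k
  proof -
    have "chords_intersect k {x1, x2} \<longleftrightarrow> chords_intersect k {y1, y2}"
      using outer_chord_intersect(1)[of A k I x1 y1 J x2 y2] CQ(2) that A xy' by auto
    moreover have "parity (insert {y1, y2} C) k = of_bool (chords_intersect k {y1, y2}) + parity C k"
      using CQ A xy' by (intro parity_outer[of C A]) auto
    ultimately show ?thesis using CQ(1) ne by (cases "chords_intersect k {y1, y2}") (simp_all add: parity_insert)
  qed
  then show ?thesis unfolding decorated_diagram_def ch decorate_def by auto
qed

text \<open>
  One prechord moves with its endpoints along two disjoint strands, the other prechords stay away
  from them, and no decoration changes. Pushing one endpoint after the other gives a homeomorphism of
  the circle that carries the first diagram to the second.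
\<close>

lemma reduced_class_move_chord:
  assumes I: "0 < fst I" "snd I < 1" "strand_params I \<subseteq> A" "u \<in> inner_params I" "u' \<in> inner_params I"
    and J: "0 < fst J" "snd J < 1" "strand_params J \<subseteq> A" "v \<in> inner_params J" "v' \<in> inner_params J"
    and disj: "strand_params I \<inter> strand_params J = {}"
    and Q: "finite Q" "\<And>k. k \<in> Q \<Longrightarrow> chord_avoiding A k"
    and par: "\<And>k. k \<in> Q \<Longrightarrow> parity C k = parity C' k" "parity C {u, v} = parity C' {u', v'}"
  shows "reduced_class (decorate C (insert {u, v} Q)) = reduced_class (decorate C' (insert {u', v'} Q))"
proof -
  obtain f where f: "circle_homeo f" "circle_act f u = u'"
    "\<And>x. x \<in> {0..<1} \<Longrightarrow> x \<notin> strand_params I \<Longrightarrow> circle_act f x = x"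
    using circle_homeo_moving_point[OF I(4,5,1,2)] by blast
  obtain g where g: "circle_homeo g" "circle_act g v = v'"
    "\<And>x. x \<in> {0..<1} \<Longrightarrow> x \<notin> strand_params J \<Longrightarrow> circle_act g x = x"
    using circle_homeo_moving_point[OF J(4,5,1,2)] by blast
  have range: "u \<in> {0..<1}" "u' \<in> {0..<1}" "v \<in> {0..<1}" "v' \<in> {0..<1}"
    using I J by (auto simp: inner_params_def)
  have mem: "u \<in> strand_params I" "u' \<in> strand_params I" "v \<in> strand_params J" "v' \<in> strand_params J"
    using I(4,5) J(4,5) inner_paramsD by blast+
  then have notin: "u' \<notin> strand_params J" "v \<notin> strand_params I" using disj by auto
  have gf: "circle_act (g \<circ> f) x = circle_act g (circle_act f x)" for x using circle_act_comp[OF g(1)] .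
  \<comment> \<open>The push along \<open>J\<close> fixes \<open>u'\<close>, and the one along \<open>I\<close> fixes \<open>v\<close>.\<close>
  have moved: "circle_act (g \<circ> f) ` {u, v} = {u', v'}"
    using f(2) f(3)[OF range(3) notin(2)] g(2) g(3)[OF range(2) notin(1)] by (simp add: gf)
  have fixed: "circle_act (g \<circ> f) ` k = k" if kQ: "k \<in> Q" for k
  proof -
    obtain p q where k: "k = {p, q}" "{p, q} \<subseteq> {0..<1} - A"
      using Q(2)[OF kQ] unfolding chord_avoiding_def by blast
    have "circle_act (g \<circ> f) x = x" if "x \<in> {0..<1} - A" for x
    proof -
      have "x \<notin> strand_params I" "x \<notin> strand_params J" using that I(3) J(3) by auto
      then show ?thesis using that f(3)[of x] g(3)[of x] by (simp add: gf)
    qed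
    then show ?thesis using k by simp
  qed
  have "act (g \<circ> f) (decorate C (insert {u, v} Q)) = decorate C' (insert {u', v'} Q)"
  proof -
    have "act (g \<circ> f) (decorate C Q) = decorate C' Q"
      unfolding act_def decorate_def image_image using fixed par(1) by (intro image_cong) simp_all
    moreover have "act (g \<circ> f) (decorate C {{u, v}}) = decorate C' {{u', v'}}"
      unfolding act_def decorate_def using moved par(2) by simp
    ultimately show ?thesis by (simp add: act_def decorate_def)
  qed
  moreover have "based (decorate C (insert {u, v} Q))"
  proof (rule based_decorate)
    have "u \<noteq> v" using mem notin by auto
    then have "chord_avoiding {} {u, v}" using range unfolding chord_avoiding_def by blast
    moreover have "chord_avoiding {} k" if "k \<in> Q" for k
      using Q(2)[OF that] unfolding chord_avoiding_def by blast
    ultimately show "chord_avoiding {} k" if "k \<in> insert {u, v} Q" for k using that by blast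
  qed (use Q in simp)
  ultimately show ?thesis
    using reduced_class_act[OF circle_homeo_comp[OF g(1) f(1)], of "decorate C (insert {u, v} Q)"]
    by (simp only:)
qed

text \<open>
  The classical chord and the prechord exchange endpoints on both strands. Each exchange toggles
  whether they intersect, so the decoration of the prechord is unchanged.
\<close>

lemma PR2_invariant:
  assumes D: "pseudodiagram D" "pseudodiagram D'" and move: "PR2_move D D'"
  shows "reduced_class (decorated_diagram D) = reduced_class (decorated_diagram D')"
proof -
  obtain I J x1 x2 y1 y2 x1' x2' y1' y2' where loc: "local_change D D' [I, J]"
    and inI: "{x1, y1, x1', y1'} \<subseteq> inner_params I"
    and inJ: "{x2, y2, x2', y2'} \<subseteq> inner_params J"
    and ne: "x1 \<noteq> y1" "x2 \<noteq> y2" "x1' \<noteq> y1'" "x2' \<noteq> y2'"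
    and order: "x1 < y1 \<longleftrightarrow> y1' < x1'" "x2 < y2 \<longleftrightarrow> y2' < x2'"
    and tang: "tangle D [I, J] {(x1, x2), (y1, y2)} {(x1, x2)}"
      "tangle D' [I, J] {(x1', x2'), (y1', y2')} {(x2', x1')}"
    using move unfolding PR2_move_def by (elim exE conjE) (rule that)
  define A where "A = all_params [I, J]"
  have A: "strand_params I \<subseteq> A" "strand_params J \<subseteq> A" by (auto simp: A_def all_params_def)
  have disj: "strand_params I \<inter> strand_params J = {}" using local_change_disjoint[OF loc] by simp
  have memI: "x1 \<in> strand_params I" "y1 \<in> strand_params I" "x1' \<in> strand_params I" "y1' \<in> strand_params I"
    and memJ: "x2 \<in> strand_params J" "y2 \<in> strand_params J" "x2' \<in> strand_params J" "y2' \<in> strand_params J"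
    using inI inJ by (simp_all add: inner_paramsD)
  have neIJ: "s \<noteq> t" if "s \<in> strand_params I" "t \<in> strand_params J" for s t using that disj by blast
  have inner: "{(x1, x2), (y1, y2)} - ({(x1, x2)} \<union> {(x1, x2)}\<inverse>) = {(y1, y2)}"
    "{(x1', x2'), (y1', y2')} - ({(x2', x1')} \<union> {(x2', x1')}\<inverse>) = {(y1', y2')}"
    using ne neIJ[of y1 x2] neIJ[of y1' x2'] neIJ[of x1' x2'] memI memJ by auto
  obtain C Q where CQ: "finite C" "finite Q" "\<And>k. k \<in> C \<union> Q \<Longrightarrow> chord_avoiding A k"
    and raw: "chords_of (over D) = C \<union> chords_of {(x1, x2)}"
      "chords_of (over D') = C \<union> chords_of {(x2', x1')}"
      "chords_of (precrossing_pairs D) = Q \<union> chords_of {(y1, y2)}"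
      "chords_of (precrossing_pairs D') = Q \<union> chords_of {(y1', y2')}"
    by (rule local_change_decomposition[OF D loc tang, folded A_def, unfolded inner]) (rule that)
  have ch: "chords_of (over D) = insert {x1, x2} C" "chords_of (over D') = insert {x1', x2'} C"
      "chords_of (precrossing_pairs D) = insert {y1, y2} Q"
      "chords_of (precrossing_pairs D') = insert {y1', y2'} Q"
    unfolding raw by (simp_all add: insert_commute)
  have par: "parity (insert {s, t} C) k = of_bool (chords_intersect k {s, t}) + parity C k"
    if "s \<in> strand_params I" for s t k
    using CQ A that by (intro parity_outer[of C A]) auto
  have outer: "parity (insert {x1, x2} C) k = parity (insert {x1', x2'} C) k" if "k \<in> Q" for k
    using outer_chord_intersect(1)[OF _ A(1) memI(1,3) A(2) memJ(1,3), of k] CQ(3) that memI by (simp add: par)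
  have "parity C {y1, y2} = parity C {y1', y2'}"
    using outer_chord_intersect(2)[OF _ A(1) memI(2,4) A(2) memJ(2,4)] CQ(3) by (intro parity_cong) simp
  moreover have "chords_intersect {y1, y2} {x1, x2} \<longleftrightarrow> chords_intersect {y1', y2'} {x1', x2'}"
  proof -
    \<comment> \<open>One strand at a time, through a diagram in which only the endpoints on \<open>I\<close> are exchanged.\<close>
    have "chords_intersect {y1', y2} {x1', x2} \<longleftrightarrow> \<not> chords_intersect {y1, y2} {x1, x2}"
      by (rule chords_intersect_exchange_endpoints[of _ _ _ _ I])
        (use memI memJ ne order disj in auto)
    moreover have "chords_intersect {y2', y1'} {x2', x1'} \<longleftrightarrow> \<not> chords_intersect {y2, y1'} {x2, x1'}"
      by (rule chords_intersect_exchange_endpoints[of _ _ _ _ J])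
        (use memI memJ ne order disj in auto)
    ultimately show ?thesis by (simp add: insert_commute)
  qed
  ultimately have "parity (insert {x1, x2} C) {y1, y2} = parity (insert {x1', x2'} C) {y1', y2'}"
    using memI by (simp add: par)
  then show ?thesis
    unfolding decorated_diagram_def ch
    using local_change_strands[OF loc] inI inJ A disj CQ outer
    by (intro reduced_class_move_chord[where I = I and J = J and A = A]) simp_all
qed

lemma slide_paramsD:
  assumes "slide_params I u v u' v'"
  shows "u \<in> strand_params I" "v \<in> strand_params I" "u' \<in> strand_params I" "v' \<in> strand_params I"
    "u \<noteq> v" "u' \<noteq> v'" "u < v \<longleftrightarrow> v' < u'"
  using assms by (auto simp: slide_params_def inner_paramsD)

text \<open>All three chords are classical and connect the same strands before and after the move, so no
  prechord notices the exchange of their endpoints.\<close>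

lemma R3_invariant:
  assumes D: "pseudodiagram D" "pseudodiagram D'" and move: "R3_move D D'"
  shows "decorated_diagram D = decorated_diagram D'"
proof -
  obtain I J K x12 x13 x21 x23 x31 x32 y12 y13 y21 y23 y31 y32
    where loc: "local_change D D' [I, J, K]"
    and slides: "slide_params I x12 x13 y12 y13" "slide_params J x21 x23 y21 y23"
      "slide_params K x31 x32 y31 y32"
    and tang: "tangle D [I, J, K] {(x12, x21), (x13, x31), (x23, x32)}
        {(x12, x21), (x13, x31), (x23, x32)}"
      "tangle D' [I, J, K] {(y12, y21), (y13, y31), (y23, y32)}
        {(y12, y21), (y13, y31), (y23, y32)}"
    using move unfolding R3_move_def by (elim exE conjE) (rule that)
  define A where "A = all_params [I, J, K]"
  have A: "strand_params I \<subseteq> A" "strand_params J \<subseteq> A" "strand_params K \<subseteq> A"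
    by (auto simp: A_def all_params_def)
  have disj: "strand_params I \<inter> strand_params J = {}" "strand_params I \<inter> strand_params K = {}"
    "strand_params J \<inter> strand_params K = {}"
    using local_change_disjoint[OF loc] by simp_all
  note s = slide_paramsD[OF slides(1)] slide_paramsD[OF slides(2)] slide_paramsD[OF slides(3)]
  obtain C Q where CQ: "finite C" "finite Q" "\<And>k. k \<in> C \<union> Q \<Longrightarrow> chord_avoiding A k"
    and ch: "chords_of (over D) = C \<union> chords_of {(x12, x21), (x13, x31), (x23, x32)}"
      "chords_of (over D') = C \<union> chords_of {(y12, y21), (y13, y31), (y23, y32)}"
      "chords_of (precrossing_pairs D) = Q \<union> chords_of ({(x12, x21), (x13, x31), (x23, x32)} -
        ({(x12, x21), (x13, x31), (x23, x32)} \<union> {(x12, x21), (x13, x31), (x23, x32)}\<inverse>))"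
      "chords_of (precrossing_pairs D') = Q \<union> chords_of ({(y12, y21), (y13, y31), (y23, y32)} -
        ({(y12, y21), (y13, y31), (y23, y32)} \<union> {(y12, y21), (y13, y31), (y23, y32)}\<inverse>))"
    by (rule local_change_decomposition[OF D loc tang, folded A_def]) (rule that)
  have over: "chords_of (over D) = insert {x12, x21} (insert {x13, x31} (insert {x23, x32} C))"
      "chords_of (over D') = insert {y12, y21} (insert {y13, y31} (insert {y23, y32} C))"
    and pre: "chords_of (precrossing_pairs D) = Q" "chords_of (precrossing_pairs D') = Q"
    unfolding ch by auto
  have notin: "{u, t} \<notin> C" if "u \<in> A" for u t
    using CQ(3) chord_avoiding_neq[of A "{u, t}" u t] that by blast
  have par: "parity (insert {u, v} (insert {u', w} (insert {v', w'} C))) k =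
      of_bool (chords_intersect k {u, v}) + (of_bool (chords_intersect k {u', w}) +
        (of_bool (chords_intersect k {v', w'}) + parity C k))"
    if "u \<in> strand_params I" "u' \<in> strand_params I" "v \<in> strand_params J" "v' \<in> strand_params J"
      "w \<in> strand_params K" "w' \<in> strand_params K" "u \<noteq> u'" for u u' v v' w w' k
  proof -
    have "{u, v} \<notin> insert {u', w} (insert {v', w'} C)" "{u', w} \<notin> insert {v', w'} C"
      using that disj notin[of u v] notin[of u' w] A by (auto simp: doubleton_eq_iff)
    moreover have "parity (insert {v', w'} C) k = of_bool (chords_intersect k {v', w'}) + parity C k"
      using CQ A that by (intro parity_outer[of C A]) auto
    ultimately show ?thesis using CQ(1) by (simp add: parity_insert)
  qed
  have "parity (chords_of (over D)) k = parity (chords_of (over D')) k" if "k \<in> Q" for k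
  proof -
    have "chords_intersect k {x12, x21} \<longleftrightarrow> chords_intersect k {y12, y21}"
      "chords_intersect k {x13, x31} \<longleftrightarrow> chords_intersect k {y13, y31}"
      "chords_intersect k {x23, x32} \<longleftrightarrow> chords_intersect k {y23, y32}"
      using outer_chord_intersect(1)[of A k] CQ(3) that A s by blast+
    then show ?thesis unfolding over using s by (simp add: par)
  qed
  then show ?thesis unfolding decorated_diagram_def pre decorate_def by auto
qed

text \<open>In a triangle of three strands, the chords \<open>{u, v}\<close> and \<open>{x, y}\<close> share only the strand \<open>I\<close>. The
  exchange on \<open>I\<close> toggles their intersection, and the displacements on \<open>J\<close> and \<open>K\<close> have no
  effect.\<close>

lemma chords_intersect_exchange_slide:
  assumes disj: "strand_params I \<inter> strand_params J = {}" "strand_params I \<inter> strand_params K = {}"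
      "strand_params J \<inter> strand_params K = {}"
    and slide: "slide_params I u x u' x'"
    and v: "v \<in> strand_params J" "v' \<in> strand_params J" and y: "y \<in> strand_params K" "y' \<in> strand_params K"
  shows "chords_intersect {u', v'} {x', y'} \<longleftrightarrow> \<not> chords_intersect {u, v} {x, y}"
proof -
  note s = slide_paramsD[OF slide]
  have "chords_intersect {u', v'} {x', y'} \<longleftrightarrow> chords_intersect {v', u'} {x', y'}"
    by (simp add: insert_commute)
  also have "\<dots> \<longleftrightarrow> chords_intersect {v, u'} {x', y'}"
    by (rule chords_intersect_move_endpoint[OF v(2,1)]) (use disj s y in auto)
  also have "\<dots> \<longleftrightarrow> chords_intersect {y', x'} {v, u'}"
    using chords_intersect_commute[of v u' x' y'] by (simp add: insert_commute)
  also have "\<dots> \<longleftrightarrow> chords_intersect {y, x'} {v, u'}"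
    by (rule chords_intersect_move_endpoint[OF y(2,1)]) (use disj s v in auto)
  also have "\<dots> \<longleftrightarrow> chords_intersect {u', v} {x', y}"
    using chords_intersect_commute[of u' v x' y] by (simp add: insert_commute)
  also have "\<dots> \<longleftrightarrow> \<not> chords_intersect {u, v} {x, y}"
    by (rule chords_intersect_exchange_endpoints[of _ _ _ _ I]) (use disj s v y in auto)
  finally show ?thesis .
qed

text \<open>
  The prechord of strands \<open>I\<close> and \<open>J\<close> exchanges endpoints with the chord of \<open>I\<close> and \<open>K\<close> on
  \<open>I\<close> and with the chord of \<open>J\<close> and \<open>K\<close> on \<open>J\<close>. Both intersections toggle, which leaves the parity
  unchanged. Whether the third strand passes over or under is invisible in the chords.
\<close>

lemma PR3_invariant:
  assumes D: "pseudodiagram D" "pseudodiagram D'" and move: "PR3_move D D'"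
  shows "reduced_class (decorated_diagram D) = reduced_class (decorated_diagram D')"
proof -
  obtain I J K x12 x13 x21 x23 x31 x32 y12 y13 y21 y23 y31 y32 V V'
    where loc: "local_change D D' [I, J, K]"
    and slides: "slide_params I x12 x13 y12 y13" "slide_params J x21 x23 y21 y23"
      "slide_params K x31 x32 y31 y32"
    and tang: "tangle D [I, J, K] {(x12, x21), (x13, x31), (x23, x32)} V"
      "tangle D' [I, J, K] {(y12, y21), (y13, y31), (y23, y32)} V'"
    and V: "V = {(x31, x13), (x32, x23)} \<and> V' = {(y31, y13), (y32, y23)} \<or>
      V = {(x13, x31), (x23, x32)} \<and> V' = {(y13, y31), (y23, y32)}"
    using move unfolding PR3_move_def by (elim exE conjE) (rule that)
  define A where "A = all_params [I, J, K]"
  have A: "strand_params I \<subseteq> A" "strand_params J \<subseteq> A" "strand_params K \<subseteq> A"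
    by (auto simp: A_def all_params_def)
  have disj: "strand_params I \<inter> strand_params J = {}" "strand_params I \<inter> strand_params K = {}"
    "strand_params J \<inter> strand_params K = {}"
    using local_change_disjoint[OF loc] by simp_all
  note s = slide_paramsD[OF slides(1)] slide_paramsD[OF slides(2)] slide_paramsD[OF slides(3)]
  have neq: "a \<noteq> b \<and> a \<noteq> c \<and> b \<noteq> c"
    if "a \<in> strand_params I" "b \<in> strand_params J" "c \<in> strand_params K" for a b c
    using that disj by blast
  have inner: "{(x12, x21), (x13, x31), (x23, x32)} - (V \<union> V\<inverse>) = {(x12, x21)}"
    "{(y12, y21), (y13, y31), (y23, y32)} - (V' \<union> V'\<inverse>) = {(y12, y21)}"
    using V s(5,6) neq[OF s(1,8,15)] neq[OF s(1,9,16)] neq[OF s(3,10,17)] neq[OF s(3,11,18)] by auto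
  have chV: "chords_of V = {{x13, x31}, {x23, x32}}" "chords_of V' = {{y13, y31}, {y23, y32}}"
    using V by (auto simp: insert_commute)
  obtain C Q where CQ: "finite C" "finite Q" "\<And>k. k \<in> C \<union> Q \<Longrightarrow> chord_avoiding A k"
    and raw: "chords_of (over D) = C \<union> chords_of V" "chords_of (over D') = C \<union> chords_of V'"
      "chords_of (precrossing_pairs D) = Q \<union> chords_of {(x12, x21)}"
      "chords_of (precrossing_pairs D') = Q \<union> chords_of {(y12, y21)}"
    by (rule local_change_decomposition[OF D loc tang, folded A_def, unfolded inner]) (rule that)
  have ch: "chords_of (over D) = insert {x13, x31} (insert {x23, x32} C)"
      "chords_of (over D') = insert {y13, y31} (insert {y23, y32} C)"
      "chords_of (precrossing_pairs D) = insert {x12, x21} Q"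
      "chords_of (precrossing_pairs D') = insert {y12, y21} Q"
    unfolding raw chV by auto
  have par: "parity (insert {u', w} (insert {v', w'} C)) k =
      of_bool (chords_intersect k {u', w}) + (of_bool (chords_intersect k {v', w'}) + parity C k)"
    if "u' \<in> strand_params I" "v' \<in> strand_params J"
      "w \<in> strand_params K" "w' \<in> strand_params K" for u' v' w w' k
  proof -
    have "{u', w} \<notin> C"
      using CQ(3) chord_avoiding_neq[of A "{u', w}" u' w] that A by blast
    then have "{u', w} \<notin> insert {v', w'} C"
      using that disj by (auto simp: doubleton_eq_iff)
    moreover have "parity (insert {v', w'} C) k = of_bool (chords_intersect k {v', w'}) + parity C k"
      using CQ A that by (intro parity_outer[of C A]) auto
    ultimately show ?thesis using CQ(1) by (simp add: parity_insert)
  qed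
  have outer: "parity (chords_of (over D)) k = parity (chords_of (over D')) k" if "k \<in> Q" for k
  proof -
    have "chords_intersect k {x13, x31} \<longleftrightarrow> chords_intersect k {y13, y31}"
      "chords_intersect k {x23, x32} \<longleftrightarrow> chords_intersect k {y23, y32}"
      using outer_chord_intersect(1)[of A k] CQ(3) that A s by blast+
    then show ?thesis unfolding ch using s by (simp add: par)
  qed
  have "chords_intersect {y12, y21} {y13, y31} \<longleftrightarrow> \<not> chords_intersect {x12, x21} {x13, x31}"
    by (rule chords_intersect_exchange_slide[OF disj slides(1) s(8,10,15,17)])
  moreover have "chords_intersect {y21, y12} {y23, y32} \<longleftrightarrow> \<not> chords_intersect {x21, x12} {x23, x32}"
    by (rule chords_intersect_exchange_slide[OF _ disj(3,2) slides(2) s(1,3,16,18)]) (use disj(1) in blast)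
  moreover have "parity C {x12, x21} = parity C {y12, y21}"
    using outer_chord_intersect(2)[OF _ A(1) s(1,3) A(2) s(8,10)] CQ(3) by (intro parity_cong) simp
  ultimately have "parity (chords_of (over D)) {x12, x21} = parity (chords_of (over D')) {y12, y21}"
    unfolding ch using s
    by (cases "chords_intersect {x12, x21} {x13, x31}"; cases "chords_intersect {x12, x21} {x23, x32}")
      (simp_all add: par insert_commute)
  moreover have "{x12, y12} \<subseteq> inner_params I" "{x21, y21} \<subseteq> inner_params J"
    using slides by (auto simp: slide_params_def)
  ultimately show ?thesis
    unfolding decorated_diagram_def ch(3,4)
    using local_change_strands[OF loc] A disj CQ outer
    by (intro reduced_class_move_chord[where I = I and J = J and A = A]) simp_all
qed

section \<open>Homotopy invariance\<close>

lemma pseudo_move_invariant: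
  assumes "pseudo_move D D' \<or> crossing_change D D'"
  shows "reduced_class (decorated_diagram D) = reduced_class (decorated_diagram D')"
  using assms planar_isotopy_invariant R1_invariant R2_invariant R3_invariant
    PR1_invariant PR2_invariant PR3_invariant crossing_change_invariant
  unfolding pseudo_move_def by metis

lemma equivclp_invariant:
  assumes "\<And>x y. r x y \<Longrightarrow> h x = h y" "equivclp r x y"
  shows "h x = h y"
  using assms(2) by (induction rule: equivclp_induct) (use assms(1) in metis)+

theorem corollary4:
  fixes D D' :: pseudo and P P' :: gauss
  assumes "pseudodiagram D" and "pseudodiagram D'"
    and "homotopic_pseudoknots (pseudoknot_of D) (pseudoknot_of D')"
    and "is_gauss_diagram P D" and "is_gauss_diagram P' D'"
  shows "I_h P = I_h P'"
proof -
  let ?J = "\<lambda>D. reduced_class (decorated_diagram D)"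
  obtain E E' where E: "equivclp pseudo_move D E" "equivclp pseudo_move D' E'"
    "equivclp (\<lambda>E E'. pseudo_move E E' \<or> crossing_change E E') E E'"
    using assms(3) unfolding homotopic_pseudoknots_def pseudoknot_of_def by blast
  have "?J E = ?J E'"
    using equivclp_invariant[of _ ?J, OF pseudo_move_invariant E(3)] .
  moreover have "?J F = ?J F'" if "equivclp pseudo_move F F'" for F F'
    using _ that by (rule equivclp_invariant[of pseudo_move ?J]) (simp add: pseudo_move_invariant)
  ultimately have "?J D = ?J D'" using E(1,2) by simp
  then show ?thesis using assms(1,2,4,5) by (simp add: I_h_gauss_diagram)
qed

end
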